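(* Let $p$ be a prime and let $G$ be a finite $p$-group such that $G_3\le \Phi(G')\cong C_p$ and $G/\Phi(G')\cong M_p(n,m,1)$, where $n\ge m$, and $n>1$ if $p=2$. Let $w(G)=(w_{ij})$ be a characteristic matrix of $G$. Then: (1) If $w_{22}=w_{12}=0$, then $G\in\mathcal{A}_3$. (2) If $w_{22}=0$ and $w_{12}\ne 0$, then $G\in\mathcal{A}_{m+1}$. (3) If $w_{22}\ne 0$ and $w_{12}=0$, then $G\in\mathcal{A}_{n+1}$.
   Context: All groups are finite $p$-groups; $G_3=[G',G]$, $\Phi(H)$ is the Frattini subgroup of $H$, $[x,y]=x^{-1}y^{-1}xy$. An $\mathcal{A}_1$-group is a minimal non-abelian $p$-group. For a positive integer $t$, $G\in\mathcal{A}_t$ means that $G$ is a non-abelian $p$-group and the maximal index in $G$ of the minimal non-abelian subgroups of $G$ is $p^{t-1}$. For $n\ge m\ge 1$ (with $n>1$ if $p=2$), $M_p(n,m,1)=\langle a,b,c\mid a^{p^n}=b^{p^m}=c^p=1,\ [a,b]=c,\ [c,a]=[c,b]=1\rangle$. Characteristic matrix: choose $a,b\in G$ whose images $\tilde a,\tilde b$ in $G/\Phi(G')\cong M_p(n,m,1)$ are generators satisfying, with $\tilde c=[\tilde a,\tilde b]$, the relations $\tilde a^{p^n}=\tilde b^{p^m}=\tilde c^p=1$, $[\tilde c,\tilde a]=[\tilde c,\tilde b]=1$ (image of $a$ of order $p^n$, image of $b$ of order $p^m$), and put $c=[a,b]$. Then $c$ has order $p^2$, $\Phi(G')=\langle c^p\rangle$,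 and there are $w_{ij}\in F_p$ (the field with $p$ elements) with $a^{p^n}=c^{w_{11}p}$, $b^{p^m}=c^{w_{21}p}$, $[c,a]=c^{w_{12}p}$, $[c,b]=c^{w_{22}p}$. The $2\times2$ matrix $w(G)=(w_{ij})$ over $F_p$ is called a characteristic matrix of $G$ (it depends on the choice of $a,b$). *)

theory Defs
  imports
    "HOL-Algebra.Elementary_Groups"
    "HOL-Number_Theory.Residues"
    "HOL-Analysis.Finite_Cartesian_Product"
begin

section \<open>Finite p-groups\<close>

definition finite_p_group :: "nat \<Rightarrow> ('a, 'b) monoid_scheme \<Rightarrow> bool" where
  "finite_p_group p G \<longleftrightarrow>
     prime p \<and> group G \<and> finite (carrier G) \<and> (\<exists>k::nat. order G = p ^ k)"

text \<open>The convention is \<open>[x, y] = x\<inverse> y\<inverse> x y\<close>. The library's \<^const>\<open>derived\<close> is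
  generated by the elements \<open>x y x\<inverse> y\<inverse>\<close>; over a subgroup these are the same elements.\<close>

definition commutator :: "('a, 'b) monoid_scheme \<Rightarrow> 'a \<Rightarrow> 'a \<Rightarrow> 'a" where
  "commutator G x y = inv\<^bsub>G\<^esub> x \<otimes>\<^bsub>G\<^esub> inv\<^bsub>G\<^esub> y \<otimes>\<^bsub>G\<^esub> x \<otimes>\<^bsub>G\<^esub> y"

definition commutator_subgroup :: "('a, 'b) monoid_scheme \<Rightarrow> 'a set \<Rightarrow> 'a set \<Rightarrow> 'a set" where
  "commutator_subgroup G H K = generate G {commutator G x y | x y. x \<in> H \<and> y \<in> K}"

abbreviation derived_subgroup :: "('a, 'b) monoid_scheme \<Rightarrow> 'a set" where
  "derived_subgroup G \<equiv> derived G (carrier G)"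

definition maximal_subgroup :: "'a set \<Rightarrow> ('a, 'b) monoid_scheme \<Rightarrow> bool" where
  "maximal_subgroup M G \<longleftrightarrow> subgroup M G \<and> M \<noteq> carrier G \<and>
     (\<forall>K. subgroup K G \<and> M \<subseteq> K \<longrightarrow> K = M \<or> K = carrier G)"

text \<open>The intersection with the carrier only matters if there is no maximal subgroup.\<close>

definition frattini :: "('a, 'b) monoid_scheme \<Rightarrow> 'a set" where
  "frattini G = carrier G \<inter> \<Inter> {M. maximal_subgroup M G}"

definition minimal_nonabelian :: "('a, 'b) monoid_scheme \<Rightarrow> bool" where
  "minimal_nonabelian G \<longleftrightarrow> group G \<and> \<not> comm_group G \<and>
     (\<forall>K. subgroup K G \<and> K \<noteq> carrier G \<longrightarrow> comm_group (G\<lparr>carrier := K\<rparr>))"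

definition class_A :: "nat \<Rightarrow> nat \<Rightarrow> ('a, 'b) monoid_scheme \<Rightarrow> bool" where
  "class_A p t G \<longleftrightarrow> t \<ge> 1 \<and> finite_p_group p G \<and> \<not> comm_group G \<and>
     Max {card (rcosets\<^bsub>G\<^esub> H) | H. subgroup H G \<and> minimal_nonabelian (G\<lparr>carrier := H\<rparr>)}
       = p ^ (t - 1)"

section \<open>Groups given by generators and relations\<close>

text \<open>Words are lists of letters \<open>(x, e)\<close>; the letter denotes the generator \<open>x\<close> if \<open>e\<close> is true
  and its formal inverse otherwise. A relation \<open>u = v\<close> is the pair \<open>(u, v)\<close>. The generators are all
  elements of the type.\<close>

type_synonym 'x word = "('x \<times> bool) list"

inductive word_eq :: "('x word \<times> 'x word) set \<Rightarrow> 'x word \<Rightarrow> 'x word \<Rightarrow> bool"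
  for R :: "('x word \<times> 'x word) set" where
  relation: "(u, v) \<in> R \<Longrightarrow> word_eq R u v"
| cancel: "word_eq R [(x, e), (x, \<not> e)] []"
| refl: "word_eq R u u"
| sym: "word_eq R u v \<Longrightarrow> word_eq R v u"
| trans: "word_eq R u v \<Longrightarrow> word_eq R v w \<Longrightarrow> word_eq R u w"
| append: "word_eq R u v \<Longrightarrow> word_eq R u' v' \<Longrightarrow> word_eq R (u @ u') (v @ v')"

definition word_class :: "('x word \<times> 'x word) set \<Rightarrow> 'x word \<Rightarrow> 'x word set" where
  "word_class R u = {v. word_eq R u v}"

definition presented_group :: "('x word \<times> 'x word) set \<Rightarrow> 'x word set monoid" where
  "presented_group R =
     \<lparr>carrier = range (word_class R),
      monoid.mult = (\<lambda>U V. \<Union>u\<in>U. \<Union>v\<in>V. word_class R (u @ v)),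
      one = word_class R []\<rparr>"

definition word_inv :: "'x word \<Rightarrow> 'x word" where
  "word_inv u = rev (map (\<lambda>(x, e). (x, \<not> e)) u)"

definition word_commutator :: "'x word \<Rightarrow> 'x word \<Rightarrow> 'x word" where
  "word_commutator u v = word_inv u @ word_inv v @ u @ v"

abbreviation gen_word :: "'x \<Rightarrow> 'x word" where
  "gen_word x \<equiv> [(x, True)]"

lemma word_class_eq_iff: "word_class R u = word_class R v \<longleftrightarrow> word_eq R u v"
proof
  assume "word_class R u = word_class R v"
  moreover have "v \<in> word_class R v"
    by (simp add: word_class_def word_eq.refl)
  ultimately have "v \<in> word_class R u"
    by simp
  then show "word_eq R u v"
    by (simp add: word_class_def)
next
  assume uv: "word_eq R u v"
  show "word_class R u = word_class R v"
    unfolding word_class_def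
    using word_eq.trans[OF uv] word_eq.trans[OF word_eq.sym[OF uv]] by blast
qed

lemma word_eq_inv_left: "word_eq R (word_inv u @ u) []"
proof (induction u)
  case Nil
  show ?case by (simp add: word_inv_def word_eq.refl)
next
  case (Cons l u)
  obtain x e where l: "l = (x, e)" by fastforce
  have "word_eq R [(x, \<not> e), (x, e)] []"
    using word_eq.cancel[of R x "\<not> e"] by simp
  then have "word_eq R (word_inv u @ [(x, \<not> e), (x, e)] @ u) (word_inv u @ [] @ u)"
    by (intro word_eq.append word_eq.refl)
  then have "word_eq R (word_inv (l # u) @ l # u) (word_inv u @ u)"
    by (simp add: l word_inv_def)
  then show ?case
    using Cons.IH by (rule word_eq.trans)
qed

lemma presented_group_mult:
  "word_class R u \<otimes>\<^bsub>presented_group R\<^esub> word_class R v = word_class R (u @ v)"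
proof -
  have "word_class R (u' @ v') = word_class R (u @ v)"
    if "u' \<in> word_class R u" "v' \<in> word_class R v" for u' v'
  proof -
    have "word_eq R (u @ v) (u' @ v')"
      using that by (simp add: word_class_def word_eq.append)
    then show ?thesis
      unfolding word_class_eq_iff by (rule word_eq.sym)
  qed
  moreover have "u \<in> word_class R u" "v \<in> word_class R v"
    by (simp_all add: word_class_def word_eq.refl)
  ultimately have "(\<Union>u'\<in>word_class R u. \<Union>v'\<in>word_class R v. word_class R (u' @ v'))
      = word_class R (u @ v)"
    by blast
  then show ?thesis
    by (simp add: presented_group_def)
qed

lemma presented_group_group: "group (presented_group R)"
proof (rule groupI)
  show "\<one>\<^bsub>presented_group R\<^esub> \<in> carrier (presented_group R)"
    by (simp add: presented_group_def)
next
  fix X Y assume "X \<in> carrier (presented_group R)" "Y \<in> carrier (presented_group R)"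
  then obtain u v where "X = word_class R u" "Y = word_class R v"
    by (auto simp: presented_group_def)
  then show "X \<otimes>\<^bsub>presented_group R\<^esub> Y \<in> carrier (presented_group R)"
    by (simp add: presented_group_mult) (simp add: presented_group_def)
next
  fix X Y Z
  assume "X \<in> carrier (presented_group R)" "Y \<in> carrier (presented_group R)"
    "Z \<in> carrier (presented_group R)"
  then obtain u v w where "X = word_class R u" "Y = word_class R v" "Z = word_class R w"
    by (auto simp: presented_group_def)
  then show "X \<otimes>\<^bsub>presented_group R\<^esub> Y \<otimes>\<^bsub>presented_group R\<^esub> Z =
      X \<otimes>\<^bsub>presented_group R\<^esub> (Y \<otimes>\<^bsub>presented_group R\<^esub> Z)"
    by (simp add: presented_group_mult)
next
  fix X assume "X \<in> carrier (presented_group R)"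
  then obtain u where X: "X = word_class R u"
    by (auto simp: presented_group_def)
  have one: "\<one>\<^bsub>presented_group R\<^esub> = word_class R []"
    by (simp add: presented_group_def)
  show "\<one>\<^bsub>presented_group R\<^esub> \<otimes>\<^bsub>presented_group R\<^esub> X = X"
    by (simp add: X one presented_group_mult)
  have "word_class R (word_inv u) \<otimes>\<^bsub>presented_group R\<^esub> X = \<one>\<^bsub>presented_group R\<^esub>"
    by (simp add: X one presented_group_mult word_class_eq_iff word_eq_inv_left)
  moreover have "word_class R (word_inv u) \<in> carrier (presented_group R)"
    by (simp add: presented_group_def)
  ultimately show "\<exists>Y\<in>carrier (presented_group R).
      Y \<otimes>\<^bsub>presented_group R\<^esub> X = \<one>\<^bsub>presented_group R\<^esub>" by blast
qed

section \<open>The groups M\_p(n,m,1) and characteristic matrices\<close>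

datatype gen = gen_a | gen_b | gen_c

definition M_relations :: "nat \<Rightarrow> nat \<Rightarrow> nat \<Rightarrow> (gen word \<times> gen word) set" where
  "M_relations p n m =
     {(replicate (p ^ n) (gen_a, True), []),
      (replicate (p ^ m) (gen_b, True), []),
      (replicate p (gen_c, True), []),
      (word_commutator (gen_word gen_a) (gen_word gen_b), gen_word gen_c),
      (word_commutator (gen_word gen_c) (gen_word gen_a), []),
      (word_commutator (gen_word gen_c) (gen_word gen_b), [])}"

definition M_group :: "nat \<Rightarrow> nat \<Rightarrow> nat \<Rightarrow> gen word set monoid" where
  "M_group p n m = presented_group (M_relations p n m)"

definition frattini_derived :: "('a, 'b) monoid_scheme \<Rightarrow> 'a set" where
  "frattini_derived G = frattini (G\<lparr>carrier := derived_subgroup G\<rparr>)"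

text \<open>The field with \<open>p\<close> elements is \<^term>\<open>residue_ring (int p)\<close>, with carrier
  \<open>{0..p - 1}\<close>. Its elements are integers and can be used in exponents as they stand.\<close>

definition characteristic_matrix ::
    "nat \<Rightarrow> nat \<Rightarrow> nat \<Rightarrow> ('a, 'b) monoid_scheme \<Rightarrow> int ^ 2 ^ 2 \<Rightarrow> bool" where
  "characteristic_matrix p n m G w \<longleftrightarrow>
     (\<forall>i j. w $ i $ j \<in> carrier (residue_ring (int p))) \<and>
     (\<exists>a\<in>carrier G. \<exists>b\<in>carrier G.
        let Q = G Mod frattini_derived G;
            a' = frattini_derived G #>\<^bsub>G\<^esub> a;
            b' = frattini_derived G #>\<^bsub>G\<^esub> b;
            c' = commutator Q a' b';
            c = commutator G a b
        in generate Q {a', b'} = carrier Q \<and>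
           group.ord Q a' = p ^ n \<and> group.ord Q b' = p ^ m \<and>
           a' [^]\<^bsub>Q\<^esub> (p ^ n) = \<one>\<^bsub>Q\<^esub> \<and> b' [^]\<^bsub>Q\<^esub> (p ^ m) = \<one>\<^bsub>Q\<^esub> \<and> c' [^]\<^bsub>Q\<^esub> p = \<one>\<^bsub>Q\<^esub> \<and>
           commutator Q c' a' = \<one>\<^bsub>Q\<^esub> \<and> commutator Q c' b' = \<one>\<^bsub>Q\<^esub> \<and>
           a [^]\<^bsub>G\<^esub> (p ^ n) = c [^]\<^bsub>G\<^esub> (w $ 1 $ 1 * int p) \<and>
           b [^]\<^bsub>G\<^esub> (p ^ m) = c [^]\<^bsub>G\<^esub> (w $ 2 $ 1 * int p) \<and>
           commutator G c a = c [^]\<^bsub>G\<^esub> (w $ 1 $ 2 * int p) \<and>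
           commutator G c b = c [^]\<^bsub>G\<^esub> (w $ 2 $ 2 * int p))"

end

theory Submission
  imports Defs
begin

text \<open>The derived subgroup \<open>D = \<langle>c\<rangle>\<close> is cyclic of order \<open>p\<^sup>2\<close>, every nontrivial subgroup of it contains
  \<open>z = c\<^sup>p\<close>, which is central, and \<open>G/D\<close> is the direct product of cyclic groups of orders \<open>p\<^sup>n\<close> and
  \<open>p\<^sup>m\<close> generated by the images of \<open>a\<close> and \<open>b\<close>; the independence of these images comes from mapping
  \<open>M\<^sub>p(n,m,1)\<close> onto such a product. It is enough to find the least order of a non-abelian subgroup
  \<open>H\<close>: a subgroup attaining it is minimal non-abelian. Let \<open>x, y \<in> H\<close> not commute.

  If \<open>x\<close> and \<open>y\<close> centralize \<open>D\<close>, their commutator is governed by the determinant of their exponent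
  vectors modulo \<open>D\<close>. As it is nontrivial, the determinant is not divisible by \<open>p\<^sup>2\<close>, so modulo \<open>D\<close> the
  subgroup \<open>H\<close> contains \<open>a\<^sup>p\<close>, \<open>b\<^sup>p\<close> and an element outside \<open>\<langle>a\<^sup>p, b\<^sup>p\<rangle>\<close>; with \<open>z \<in> H\<close> this gives index
  at most \<open>p\<^sup>2\<close>. If \<open>c\<close> is central, \<open>\<langle>a, b\<^sup>p\<rangle>\<close> has index \<open>p\<^sup>2\<close>.

  If \<open>b\<close> centralizes \<open>c\<close> and \<open>a\<close> does not, an \<open>H\<close> that does not centralize \<open>c\<close> contains an \<open>x\<close> of
  order at least \<open>p\<^sup>n\<close> modulo \<open>D\<close>. The abelian group \<open>\<langle>x, z\<rangle>\<close> is proper in \<open>H\<close>, whence the index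
  of \<open>H\<close> is at most \<open>p\<^sup>m\<close>, which \<open>\<langle>a, c\<rangle>\<close> attains. Here \<open>m \<ge> 2\<close>, since otherwise \<open>b\<^sup>p\<close> would be
  central and \<open>c\<^sup>p = [a, b\<^sup>p] = 1\<close>. The last case follows by exchanging \<open>a\<close> and \<open>b\<close>.\<close>

section \<open>Commutator calculus\<close>

context group
begin

lemma commute_mult:
  assumes "u \<in> carrier G" "x \<in> carrier G" "y \<in> carrier G"
    and "u \<otimes> x = x \<otimes> u" "u \<otimes> y = y \<otimes> u"
  shows "u \<otimes> (x \<otimes> y) = x \<otimes> y \<otimes> u"
  using assms by (metis m_assoc)

lemma mult_inv_cancel: "x \<in> carrier G \<Longrightarrow> y \<in> carrier G \<Longrightarrow> x \<otimes> (inv x \<otimes> y) = y"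
  by (simp flip: m_assoc)

lemma mult_commutator:
  "x \<in> carrier G \<Longrightarrow> y \<in> carrier G \<Longrightarrow> x \<otimes> y = y \<otimes> x \<otimes> (inv x \<otimes> inv y \<otimes> x \<otimes> y)"
  by (simp add: m_assoc mult_inv_cancel)

lemma commutator_eq_one:
  assumes "x \<in> carrier G" "y \<in> carrier G" "inv x \<otimes> inv y \<otimes> x \<otimes> y = \<one>"
  shows "x \<otimes> y = y \<otimes> x"
  using assms by (simp add: m_assoc inv_solve_left')

lemma conj_int_pow:
  assumes "u \<in> carrier G" "v \<in> carrier G"
  shows "(inv u \<otimes> v \<otimes> u) [^] (k::int) = inv u \<otimes> v [^] k \<otimes> u"
proof -
  have "(\<lambda>x. inv u \<otimes> x \<otimes> u) \<in> hom G G"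
    using assms by (auto simp: hom_def m_assoc) (metis inv_closed m_assoc m_closed r_inv r_one l_one)
  from hom_int_pow[OF this assms(2) is_group is_group] show ?thesis by simp
qed

lemma commute_int_pow_right:
  assumes "u \<in> carrier G" "v \<in> carrier G" "u \<otimes> v = v \<otimes> u"
  shows "u \<otimes> v [^] (k::int) = v [^] k \<otimes> u"
proof -
  have "inv u \<otimes> v \<otimes> u = v"
    using assms by (simp add: inv_solve_left' m_assoc flip: assms(3))
  with conj_int_pow[OF assms(1,2), of k] have "v [^] k = inv u \<otimes> (v [^] k \<otimes> u)"
    using assms by (simp add: m_assoc)
  then show ?thesis
    using assms by (simp add: inv_solve_left)
qed

lemma commute_int_pow:
  assumes "u \<in> carrier G" "v \<in> carrier G" "u \<otimes> v = v \<otimes> u"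
  shows "u [^] (i::int) \<otimes> v [^] (j::int) = v [^] j \<otimes> u [^] i"
  using assms commute_int_pow_right[of "v [^] j" u i] commute_int_pow_right[of u v j] by simp

text \<open>Conjugation by \<open>v\<close> takes \<open>u\<close> to \<open>u \<otimes> e\<close>,
  and powers of this product split because \<open>u\<close> and \<open>e\<close> commute.\<close>

lemma int_pow_commutator_left:
  assumes "u \<in> carrier G" "v \<in> carrier G" "e \<in> carrier G"
    and "u \<otimes> v = v \<otimes> u \<otimes> e" "u \<otimes> e = e \<otimes> u"
  shows "u [^] (i::int) \<otimes> v = v \<otimes> u [^] i \<otimes> e [^] i"
proof -
  have "inv v \<otimes> u \<otimes> v = u \<otimes> e"
    using assms by (simp add: m_assoc inv_solve_left')
  then have "inv v \<otimes> u [^] i \<otimes> v = u [^] i \<otimes> e [^] i"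
    using assms by (metis conj_int_pow int_pow_mult_distrib)
  then show ?thesis
    using assms by (simp add: m_assoc inv_solve_left')
qed

lemma int_pow_commutator:
  assumes "u \<in> carrier G" "v \<in> carrier G" "e \<in> carrier G"
    and "u \<otimes> v = v \<otimes> u \<otimes> e" "u \<otimes> e = e \<otimes> u" "v \<otimes> e = e \<otimes> v"
  shows "u [^] (i::int) \<otimes> v [^] (j::int) = v [^] j \<otimes> u [^] i \<otimes> e [^] (i * j)"
proof -
  have "v \<otimes> u [^] i = u [^] i \<otimes> v \<otimes> e [^] (- i)"
    using assms by (simp add: int_pow_commutator_left m_assoc int_pow_neg)
  moreover have "v \<otimes> e [^] (- i) = e [^] (- i) \<otimes> v"
    using assms by (intro commute_int_pow_right) auto
  ultimately have "v [^] j \<otimes> u [^] i = u [^] i \<otimes> v [^] j \<otimes> (e [^] (- i)) [^] j"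
    using assms by (intro int_pow_commutator_left) auto
  then show ?thesis
    using assms by (simp add: m_assoc int_pow_pow flip: int_pow_mult)
qed

text \<open>Collection in class two: moving \<open>u [^] i'\<close> to the left past
  \<open>v [^] j\<close> costs \<open>e [^] (- (i' * j))\<close>. Only \<open>d'\<close> is moved
  past \<open>u\<close> and \<open>v\<close>; \<open>d\<close> stays in front.\<close>

lemma mult_commutator_normal_form:
  assumes carr: "u \<in> carrier G" "v \<in> carrier G" "e \<in> carrier G" "d \<in> carrier G" "d' \<in> carrier G"
    and uv: "u \<otimes> v = v \<otimes> u \<otimes> e" and e: "u \<otimes> e = e \<otimes> u" "v \<otimes> e = e \<otimes> v"
    and d': "u \<otimes> d' = d' \<otimes> u" "v \<otimes> d' = d' \<otimes> v"
  shows "d \<otimes> (u [^] (i::int) \<otimes> v [^] (j::int)) \<otimes> (d' \<otimes> (u [^] (i'::int) \<otimes> v [^] (j'::int)))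
    = d \<otimes> d' \<otimes> (u [^] (i + i') \<otimes> v [^] (j + j')) \<otimes> e [^] (- (i' * j))" (is "?l = ?r")
proof -
  have "u [^] i \<otimes> d' = d' \<otimes> u [^] i" "v [^] j \<otimes> d' = d' \<otimes> v [^] j"
    using carr d' by (metis commute_int_pow_right)+
  then have "u [^] i \<otimes> v [^] j \<otimes> d' = d' \<otimes> (u [^] i \<otimes> v [^] j)"
    using carr by (metis int_pow_closed m_assoc)
  then have "?l = d \<otimes> d' \<otimes> (u [^] i \<otimes> (v [^] j \<otimes> u [^] i') \<otimes> v [^] j')"
    using carr by (simp add: m_assoc[symmetric]) (simp add: m_assoc)
  also have "v [^] j \<otimes> u [^] i' = u [^] i' \<otimes> v [^] j \<otimes> e [^] (- (i' * j))"
    using carr int_pow_commutator[OF carr(1-3) uv e, of i' j]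
    by (simp add: m_assoc flip: int_pow_mult)
  also have "u [^] i \<otimes> (u [^] i' \<otimes> v [^] j \<otimes> e [^] (- (i' * j))) \<otimes> v [^] j'
      = u [^] i \<otimes> u [^] i' \<otimes> v [^] j \<otimes> (e [^] (- (i' * j)) \<otimes> v [^] j')"
    using carr by (simp add: m_assoc)
  also have "e [^] (- (i' * j)) \<otimes> v [^] j' = v [^] j' \<otimes> e [^] (- (i' * j))"
    using carr e by (metis commute_int_pow)
  finally show ?thesis
    using carr by (simp add: m_assoc int_pow_mult)
qed

text \<open>The normal forms of the two products differ only in the exponent of \<open>e\<close>, by
  the determinant of the exponent vectors.\<close>

lemma commute_normal_form:
  assumes carr: "u \<in> carrier G" "v \<in> carrier G" "e \<in> carrier G" "d \<in> carrier G" "d' \<in> carrier G"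
    and uv: "u \<otimes> v = v \<otimes> u \<otimes> e" and e: "u \<otimes> e = e \<otimes> u" "v \<otimes> e = e \<otimes> v"
    and d: "u \<otimes> d = d \<otimes> u" "v \<otimes> d = d \<otimes> v"
    and d': "u \<otimes> d' = d' \<otimes> u" "v \<otimes> d' = d' \<otimes> v"
    and dd': "d \<otimes> d' = d' \<otimes> d"
    and one: "e [^] (i * j' - i' * j) = \<one>"
    and x: "x = d \<otimes> (u [^] (i::int) \<otimes> v [^] (j::int))"
    and y: "y = d' \<otimes> (u [^] (i'::int) \<otimes> v [^] (j'::int))"
  shows "x \<otimes> y = y \<otimes> x"
proof -
  have "- (i' * j) = - (i * j') + (i * j' - i' * j)"
    by simp
  then have "e [^] (- (i' * j)) = e [^] (- (i * j'))"
    using carr one by (metis int_pow_closed int_pow_mult r_one)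
  then show ?thesis
    unfolding x y using mult_commutator_normal_form[OF carr uv e d', of i j i' j'] dd'
      mult_commutator_normal_form[OF carr(1-3,5,4) uv e d, of i' j' i j]
    by (simp add: add.commute)
qed

end

section \<open>Minimal non-abelian subgroups\<close>

text \<open>The gcd of \<open>k\<close> and \<open>p ^ n\<close> is a power of \<open>p\<close>
  dividing \<open>k\<close>, so it is \<open>1\<close> or \<open>p\<close>; a multiple of Bezout's
  identity yields \<open>p\<close>.\<close>

lemma prime_power_bezout:
  fixes k :: int
  assumes "prime p" and "\<not> int p ^ 2 dvd k"
  shows "\<exists>u v. k * u + int p ^ n * v = int p"
proof -
  obtain t where t: "t \<le> n" "normalize (gcd k (int p ^ n)) = normalize (int p ^ t)"
    using divides_primepow[of "int p" "gcd k (int p ^ n)" n] assms(1) by auto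
  then have g: "gcd k (int p ^ n) = int p ^ t" by simp
  have "t \<le> 1"
  proof (rule ccontr)
    assume "\<not> t \<le> 1"
    then have "int p ^ 2 dvd int p ^ t" by (intro le_imp_power_dvd) simp
    also have "\<dots> dvd k" by (metis g gcd_dvd1)
    finally show False using assms(2) by blast
  qed
  then have "int p ^ t dvd int p ^ 1" by (intro le_imp_power_dvd)
  then have "gcd k (int p ^ n) dvd int p" by (simp only: g power_one_right)
  then obtain q where q: "int p = gcd k (int p ^ n) * q" ..
  obtain u v where "u * k + v * int p ^ n = gcd k (int p ^ n)" using bezout_int by blast
  then have "(u * k + v * int p ^ n) * q = int p"
    using q by metis
  then have "k * (u * q) + int p ^ n * (v * q) = int p"
    by (simp add: algebra_simps)
  then show ?thesis by blast
qed

context group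
begin

lemma comm_group_subgroup_iff:
  assumes "subgroup H G"
  shows "comm_group (G\<lparr>carrier := H\<rparr>) \<longleftrightarrow> (\<forall>x\<in>H. \<forall>y\<in>H. x \<otimes> y = y \<otimes> x)"
proof
  assume "comm_group (G\<lparr>carrier := H\<rparr>)"
  then interpret K: comm_group "G\<lparr>carrier := H\<rparr>" .
  show "\<forall>x\<in>H. \<forall>y\<in>H. x \<otimes> y = y \<otimes> x" using K.m_comm by simp
next
  assume "\<forall>x\<in>H. \<forall>y\<in>H. x \<otimes> y = y \<otimes> x"
  then show "comm_group (G\<lparr>carrier := H\<rparr>)"
    using group.group_comm_groupI[OF subgroup_imp_group[OF assms]] by simp
qed

text \<open>By \<open>lower\<close>, a non-abelian subgroup of \<open>E\<close> is as large as
  \<open>E\<close>, so \<open>E\<close> is minimal non-abelian, of index \<open>p ^ k\<close>; the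
  same bound limits the index of every competitor.\<close>

lemma class_A_I:
  assumes p: "prime p" and fin: "finite (carrier G)" and order: "order G = p ^ (e + k)"
    and lower: "\<And>H x y. \<lbrakk>subgroup H G; x \<in> H; y \<in> H; x \<otimes> y \<noteq> y \<otimes> x\<rbrakk> \<Longrightarrow> p ^ e \<le> card H"
    and E: "subgroup E G" "x \<in> E" "y \<in> E" "x \<otimes> y \<noteq> y \<otimes> x" "card E \<le> p ^ e"
  shows "class_A p (k + 1) G"
proof -
  let ?S = "{card (rcosets H) | H. subgroup H G \<and> minimal_nonabelian (G\<lparr>carrier := H\<rparr>)}"
  have p0: "p > 0" using p prime_gt_0_nat by blast
  have cardE: "card E = p ^ e" using lower[OF E(1-4)] E(5) by simp
  have finE: "finite E" using E(1) fin finite_subset subgroup.subset by blast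
  have "K = E" if K: "subgroup K (G\<lparr>carrier := E\<rparr>)" "\<not> comm_group (G\<lparr>carrier := K\<rparr>)" for K
  proof -
    have KG: "subgroup K G" using K(1) E(1) incl_subgroup by blast
    then have "p ^ e \<le> card K" using K(2) comm_group_subgroup_iff lower by blast
    moreover have "K \<subseteq> E" using subgroup.subset[OF K(1)] by simp
    ultimately show ?thesis using cardE finE card_subset_eq[of E K] card_mono[of E K] by simp
  qed
  then have minE: "minimal_nonabelian (G\<lparr>carrier := E\<rparr>)"
    unfolding minimal_nonabelian_def
    using subgroup_imp_group[OF E(1)] comm_group_subgroup_iff[OF E(1)] E(2-4) by auto
  have index: "card (rcosets H) * card H = p ^ e * p ^ k" if "subgroup H G" for H
    using lagrange[OF that] order by (simp add: power_add)
  have "card (rcosets E) = p ^ k" using index[OF E(1)] cardE p0 by simp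
  then have mem: "p ^ k \<in> ?S" using E(1) minE by force
  have le: "t \<le> p ^ k" if "t \<in> ?S" for t
  proof -
    from that obtain H where H: "t = card (rcosets H)" "subgroup H G"
      "minimal_nonabelian (G\<lparr>carrier := H\<rparr>)" by blast
    then have "p ^ e \<le> card H"
      using lower comm_group_subgroup_iff[OF H(2)] unfolding minimal_nonabelian_def by blast
    then have "t * p ^ e \<le> p ^ k * p ^ e"
      using index[OF H(2)] H(1) by (metis mult.commute mult_le_mono2)
    then show ?thesis using p0 by simp
  qed
  have "finite ?S" using le by (meson finite_nat_set_iff_bounded_le)
  then have "Max ?S = p ^ k" using mem le by (intro Max_eqI)
  moreover have "\<not> comm_group G"
  proof
    assume "comm_group G"
    then interpret C: comm_group G .
    show False using E C.m_comm subgroup.mem_carrier by metis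
  qed
  ultimately show ?thesis
    unfolding class_A_def finite_p_group_def using p fin order is_group by auto
qed

text \<open>Sharpens a strict inclusion by a factor \<open>p\<close>: the order of \<open>H\<close>
  is a power of \<open>p\<close> larger than \<open>p ^ k\<close>.\<close>

lemma prime_power_card_subgroup:
  assumes p: "prime p" and fin: "finite (carrier G)" and order: "order G = p ^ N"
    and H: "subgroup H G" and S: "S \<subset> H" "card S = p ^ k"
  shows "p ^ (k + 1) \<le> card H"
proof -
  have finH: "finite H" using H fin finite_subset subgroup.subset by blast
  have "card H dvd p ^ N" using lagrange[OF H] order by (metis dvd_triv_right)
  then obtain t where t: "card H = p ^ t" using divides_primepow_nat[OF p] by blast
  have "p ^ k < p ^ t" using psubset_card_mono[OF finH S(1)] S(2) t by simp
  then have "k < t" using p power_less_imp_less_exp prime_gt_1_nat by blast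
  then show ?thesis using t p by (simp add: power_increasing prime_gt_0_nat Suc_leI del: power_Suc)
qed

end

section \<open>Cyclic derived subgroup of order \<open>p\<^sup>2\<close>\<close>

text \<open>\<open>conj_a\<close> and \<open>conj_b\<close> say that \<open>a\<close> and
  \<open>b\<close> centralize \<open>D\<close> modulo the powers of \<open>c [^] p\<close>. No order
  relation ties \<open>r\<close> to \<open>s\<close>, so that \<open>a\<close> and \<open>b\<close>
  can be exchanged.\<close>

locale cyclic_derived_p_group = group G for G (structure) +
  fixes p r s :: nat and a b c :: 'a
  assumes prime_p: "prime p" and r_pos: "1 \<le> r" and s_pos: "1 \<le> s"
    and finite_G: "finite (carrier G)" and order_G: "order G = p ^ (r + s + 2)"
    and abc_closed [simp]: "a \<in> carrier G" "b \<in> carrier G" "c \<in> carrier G"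
    and ord_c: "ord c = p ^ 2"
    and derived_eq: "derived G (carrier G) = generate G {c}"
    and ab: "a \<otimes> b = b \<otimes> a \<otimes> c"
    and conj_a: "\<exists>k::int. inv a \<otimes> c \<otimes> a = c [^] (1 + k * int p)"
    and conj_b: "\<exists>k::int. inv b \<otimes> c \<otimes> b = c [^] (1 + k * int p)"
    and a_pow: "\<exists>k::int. a [^] (int p ^ r) = c [^] (k * int p)"
    and b_pow: "\<exists>k::int. b [^] (int p ^ s) = c [^] (k * int p)"
    and span: "\<And>x. x \<in> carrier G \<Longrightarrow>
      \<exists>(i::int) (j::int). \<exists>d\<in>derived G (carrier G). x = d \<otimes> (a [^] i \<otimes> b [^] j)"
    and indep: "\<And>(i::int) (j::int). a [^] i \<otimes> b [^] j \<in> derived G (carrier G) \<Longrightarrow>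
      int p ^ r dvd i \<and> int p ^ s dvd j"
begin

abbreviation D where "D \<equiv> derived G (carrier G)"

lemma D_eq: "D = range (\<lambda>k::int. c [^] k)"
  unfolding derived_eq using generate_pow[of c] by auto

lemma c_pow_D [simp]: "c [^] (k::int) \<in> D"
  by (simp add: D_eq)

lemma D_closed: "d \<in> D \<Longrightarrow> d \<in> carrier G"
  using derived_in_carrier by blast

lemma c_pow_eq_one: "c [^] (k::int) = \<one> \<longleftrightarrow> int p ^ 2 dvd k"
  using int_pow_eq_id[of c k] ord_c by simp

lemma D_commute: "d \<in> D \<Longrightarrow> d' \<in> D \<Longrightarrow> d \<otimes> d' = d' \<otimes> d"
  by (auto simp: D_eq add.commute simp flip: int_pow_mult)

lemma commute_D:
  assumes "u \<in> carrier G" "u \<otimes> c = c \<otimes> u" "d \<in> D"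
  shows "u \<otimes> d = d \<otimes> u"
  using assms commute_int_pow_right[of u c] by (auto simp: D_eq)

section \<open>The abelian quotient by \<open>D\<close> and exponents in it\<close>

sublocale D: normal D G
  by (rule derived_self_is_normal)

sublocale Q: comm_group "G Mod D"
  by (rule derived_quot_is_comm_group)

text \<open>Quotient operations stay folded, so that the laws of the abelian group \<open>Q\<close>
  apply instead of products of cosets.\<close>

declare mult_FactGroup [simp del] one_FactGroup [simp del]

text \<open>A relation and not a function: the exponents of an element modulo \<open>D\<close> are
  determined only modulo \<open>p ^ r\<close> and \<open>p ^ s\<close>, and any representing
  integers are allowed.\<close>

definition coords :: "'a \<Rightarrow> int \<Rightarrow> int \<Rightarrow> bool" where
  "coords x i j \<longleftrightarrow> (\<exists>d\<in>D. x = d \<otimes> (a [^] i \<otimes> b [^] j))"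

lemma coset_closed [simp]: "x \<in> carrier G \<Longrightarrow> D #> x \<in> carrier (G Mod D)"
  using hom_in_carrier[OF D.r_coset_hom_Mod] .

lemma coset_mult:
  "x \<in> carrier G \<Longrightarrow> y \<in> carrier G \<Longrightarrow>
    D #> (x \<otimes> y) = (D #> x) \<otimes>\<^bsub>G Mod D\<^esub> (D #> y)"
  using hom_mult[OF D.r_coset_hom_Mod] .

lemma coset_eq_iff:
  assumes xy: "x \<in> carrier G" "y \<in> carrier G"
  shows "D #> x = D #> y \<longleftrightarrow> (\<exists>d\<in>D. x = d \<otimes> y)"
proof
  assume "D #> x = D #> y"
  then have "x \<in> D #> y" using rcos_self[OF xy(1) D.subgroup_axioms] by simp
  then show "\<exists>d\<in>D. x = d \<otimes> y" by (auto simp: r_coset_def)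
next
  assume "\<exists>d\<in>D. x = d \<otimes> y"
  then have "x \<in> D #> y" by (auto simp: r_coset_def)
  then show "D #> x = D #> y" using repr_independence[OF _ xy(2) D.subgroup_axioms] by simp
qed

text \<open>Turns the factor in \<open>D\<close> into an equation in the abelian group
  \<open>G Mod D\<close>, where the rules for coordinates become exponent laws.\<close>

lemma coords_iff:
  "coords x i j \<longleftrightarrow> x \<in> carrier G \<and>
    D #> x = (D #> a) [^]\<^bsub>G Mod D\<^esub> i \<otimes>\<^bsub>G Mod D\<^esub> (D #> b) [^]\<^bsub>G Mod D\<^esub> j"
proof -
  have "D #> (a [^] i \<otimes> b [^] j)
      = (D #> a) [^]\<^bsub>G Mod D\<^esub> i \<otimes>\<^bsub>G Mod D\<^esub> (D #> b) [^]\<^bsub>G Mod D\<^esub> j"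
    by (simp add: D.FactGroup_int_pow coset_mult)
  moreover have "coords x i j \<longleftrightarrow> x \<in> carrier G \<and> (\<exists>d\<in>D. x = d \<otimes> (a [^] i \<otimes> b [^] j))"
    unfolding coords_def using D_closed by auto
  ultimately show ?thesis
    using coset_eq_iff[of x "a [^] i \<otimes> b [^] j"] by auto
qed

lemma coords_closed: "coords x i j \<Longrightarrow> x \<in> carrier G"
  by (simp add: coords_iff)

lemma coords_mult:
  "coords x i j \<Longrightarrow> coords y i' j' \<Longrightarrow> coords (x \<otimes> y) (i + i') (j + j')"
  unfolding coords_iff
  by (auto simp: coset_mult Q.int_pow_mult Q.m_ac)

lemma coords_int_pow: "coords x i j \<Longrightarrow> coords (x [^] (k::int)) (k * i) (k * j)"
  unfolding coords_iff
  by (auto simp: D.FactGroup_int_pow[symmetric] Q.int_pow_distrib Q.int_pow_pow mult.commute)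

lemma coords_inv: "coords x i j \<Longrightarrow> coords (inv x) (- i) (- j)"
  using coords_int_pow[of x i j "-1"] by (auto simp: coords_closed int_pow_neg)

lemma coords_generators: "coords a 1 0" "coords b 0 1"
  by (simp_all add: coords_iff)

lemma coords_D: "d \<in> D \<Longrightarrow> coords d 0 0"
  unfolding coords_def using D_closed by auto

lemma coords_unique:
  assumes "coords x i j" "coords x i' j'"
  shows "int p ^ r dvd i - i'" "int p ^ s dvd j - j'"
proof -
  have "coords (x \<otimes> inv x) (i + - i') (j + - j')"
    using assms coords_mult coords_inv by blast
  then have 1: "coords \<one> (i - i') (j - j')"
    using assms coords_closed by simp
  then obtain d where d: "d \<in> D" "d \<otimes> (a [^] (i - i') \<otimes> b [^] (j - j')) = \<one>"
    unfolding coords_def by metis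
  then have "a [^] (i - i') \<otimes> b [^] (j - j') = inv d"
    using D_closed by (metis abc_closed(1,2) int_pow_closed inv_equality inv_inv m_closed)
  then have "a [^] (i - i') \<otimes> b [^] (j - j') \<in> D"
    using d(1) by simp
  then show "int p ^ r dvd i - i'" "int p ^ s dvd j - j'"
    using indep by blast+
qed

text \<open>By \<open>a_pow\<close> and \<open>b_pow\<close>, the added powers of \<open>a\<close>
  and \<open>b\<close> lie in \<open>D\<close>.\<close>

lemma coords_cong:
  assumes "coords x i j"
  shows "coords x (i + int p ^ r * k) (j + int p ^ s * l)"
proof -
  have 1: "coords (g [^] (int p ^ t * k)) 0 0"
    if "g [^] (int p ^ t) = c [^] (k' * int p)" "g \<in> carrier G" for g t k k'
  proof -
    have "g [^] (int p ^ t * k) = (g [^] (int p ^ t)) [^] k"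
      using that(2) by (simp add: int_pow_pow)
    also have "\<dots> = c [^] (k' * int p * k)"
      by (simp only: that(1) int_pow_pow abc_closed)
    finally show ?thesis by (metis c_pow_D coords_D)
  qed
  have "coords (a [^] (int p ^ r * k)) 0 0" "coords (b [^] (int p ^ s * l)) 0 0"
    using a_pow b_pow 1 by auto
  moreover have "coords (a [^] (int p ^ r * k)) (int p ^ r * k) 0"
    "coords (b [^] (int p ^ s * l)) 0 (int p ^ s * l)"
    using coords_generators[THEN coords_int_pow] by fastforce+
  ultimately have
    "(D #> a) [^]\<^bsub>G Mod D\<^esub> (int p ^ r * k) = \<one>\<^bsub>G Mod D\<^esub>"
    "(D #> b) [^]\<^bsub>G Mod D\<^esub> (int p ^ s * l) = \<one>\<^bsub>G Mod D\<^esub>"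
    unfolding coords_iff by auto
  then show ?thesis
    using assms unfolding coords_iff by (simp add: Q.int_pow_mult)
qed

lemma coords_exist: "x \<in> carrier G \<Longrightarrow> \<exists>i j. coords x i j"
  unfolding coords_def by (erule span)

section \<open>The central subgroup generated by \<open>c [^] p\<close>\<close>

lemma p_pos: "0 < p"
  using prime_p prime_gt_0_nat by blast

text \<open>Conjugation multiplies exponents of \<open>c\<close> by \<open>1 + k * p\<close>, and
  \<open>(1 + k * p) * p\<close> is \<open>p\<close> modulo the order \<open>p ^ 2\<close> of
  \<open>c\<close>.\<close>

lemma cp_power_conj:
  assumes "u \<in> carrier G" "\<exists>k::int. inv u \<otimes> c \<otimes> u = c [^] (1 + k * int p)"
  shows "u \<otimes> c [^] int p = c [^] int p \<otimes> u"
proof -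
  obtain k :: int where k: "inv u \<otimes> c \<otimes> u = c [^] (1 + k * int p)" using assms by blast
  have "inv u \<otimes> c [^] int p \<otimes> u = (c [^] (1 + k * int p)) [^] int p"
    using assms(1) by (simp add: conj_int_pow[symmetric] k)
  also have "\<dots> = c [^] (int p + int p ^ 2 * k)"
    by (simp add: int_pow_pow algebra_simps power2_eq_square)
  also have "\<dots> = c [^] int p"
    using c_pow_eq_one[of "int p ^ 2 * k"] by (simp add: int_pow_mult)
  finally show ?thesis
    using assms(1) by (simp add: m_assoc inv_solve_left')
qed

lemma cp_central:
  assumes "x \<in> carrier G"
  shows "x \<otimes> c [^] (int p * k) = c [^] (int p * k) \<otimes> x"
proof -
  let ?z = "c [^] int p"
  obtain i :: int and j :: int and d where x: "d \<in> D" "x = d \<otimes> (a [^] i \<otimes> b [^] j)"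
    using span[OF assms] by blast
  have d: "d \<in> carrier G" "?z \<otimes> d = d \<otimes> ?z"
    using x D_closed D_commute by auto
  have "?z \<otimes> a [^] i = a [^] i \<otimes> ?z" "?z \<otimes> b [^] j = b [^] j \<otimes> ?z"
    using cp_power_conj[OF _ conj_a] cp_power_conj[OF _ conj_b]
    by (simp_all add: commute_int_pow_right)
  then have "?z \<otimes> x = x \<otimes> ?z"
    using d unfolding x(2) by (intro commute_mult) auto
  then have "x \<otimes> (?z [^] k) = (?z [^] k) \<otimes> x"
    using assms commute_int_pow_right[of x ?z k] by simp
  then show ?thesis by (simp add: int_pow_pow)
qed

lemma commutator_mem_D:
  assumes "x \<in> carrier G" "y \<in> carrier G"
  shows "inv x \<otimes> inv y \<otimes> x \<otimes> y \<in> D"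
proof -
  \<comment> \<open>The library's commutators have the inverses last, so the inverses of
    \<open>x\<close> and \<open>y\<close> are inserted.\<close>
  have "inv x \<otimes> inv y \<otimes> inv (inv x) \<otimes> inv (inv y) \<in> derived_set G (carrier G)"
    using assms inv_closed by blast
  then show ?thesis
    using assms unfolding derived_def by (simp add: generate.incl)
qed

text \<open>The commutator of \<open>x\<close> and \<open>y\<close> is some \<open>c [^] t\<close>
  with \<open>t\<close> not divisible by \<open>p ^ 2\<close>, so Bezout turns a power of it into
  \<open>c [^] p\<close>.\<close>

lemma cp_mem_nonabelian:
  assumes H: "subgroup H G" and xy: "x \<in> H" "y \<in> H" "x \<otimes> y \<noteq> y \<otimes> x"
  shows "c [^] (int p * k) \<in> H"
proof -
  let ?w = "inv x \<otimes> inv y \<otimes> x \<otimes> y"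
  have carr: "x \<in> carrier G" "y \<in> carrier G"
    using subgroup.mem_carrier[OF H] xy by blast+
  obtain t :: int where t: "?w = c [^] t"
    using commutator_mem_D[OF carr] unfolding D_eq by blast
  have wH: "?w \<in> H"
    using H xy by (simp add: subgroup.m_closed subgroup.m_inv_closed)
  have "?w \<noteq> \<one>"
    using commutator_eq_one[OF carr] xy(3) by blast
  then have "\<not> int p ^ 2 dvd t"
    using c_pow_eq_one t by simp
  then obtain u v where uv: "t * u + int p ^ 2 * v = int p"
    using prime_power_bezout[OF prime_p] by blast
  then have "c [^] int p = c [^] (t * u) \<otimes> c [^] (int p ^ 2 * v)"
    by (metis int_pow_mult abc_closed(3))
  then have "c [^] int p = ?w [^] u"
    using c_pow_eq_one[of "int p ^ 2 * v"] by (simp add: t int_pow_pow)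
  then have "c [^] (int p * k) = ?w [^] (u * k)"
    using carr by (metis abc_closed(3) int_pow_closed int_pow_pow t)
  then show ?thesis
    using subgroup_int_pow_closed[OF H wH] by simp
qed

text \<open>The elements over \<open>p\<int> \<times> p\<int>\<close> form a proper subset with at least \<open>p\<^bsup>r+s-1\<^esup>\<close> elements.\<close>

lemma card_subgroup_ge:
  assumes H: "subgroup H G" and z: "\<And>k. c [^] (int p * k) \<in> H"
    and g: "g \<in> H" "coords g (int p) 0" and h: "h \<in> H" "coords h 0 (int p)"
    and x: "x \<in> H" "coords x i j" "\<not> (int p dvd i \<and> int p dvd j)"
  shows "p ^ (r + s) \<le> card H"
proof -
  let ?f = "\<lambda>(i, j, k). g [^] int i \<otimes> h [^] int j \<otimes> c [^] (int p * int k)"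
  let ?I = "{..<p ^ (r - 1)} \<times> {..<p ^ (s - 1)} \<times> {..<p}"
  have pr: "int p ^ r = int p * int p ^ (r - 1)" "int p ^ s = int p * int p ^ (s - 1)"
    using r_pos s_pos by (simp_all add: power_eq_if)
  have f: "coords (?f (i, j, k)) (int i * int p) (int j * int p)" for i j k
    using coords_mult[OF coords_mult[OF coords_int_pow[OF g(2), of "int i"]
          coords_int_pow[OF h(2), of "int j"]] coords_D[OF c_pow_D, of "int p * int k"]]
    by simp
  \<comment> \<open>Serves the two coordinates and, with \<open>q = p\<close>, the exponent of
    \<open>c\<close>.\<close>
  have small: "i = i'"
    if "int p * q dvd int i * int p - int i' * int p" "int i < q" "int i' < q" for i i' q
  proof -
    have "int p * q dvd int p * (int i - int i')"
      using that(1) by (simp add: algebra_simps)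
    then have "q dvd int i - int i'" using p_pos by simp
    then have "int i mod q = int i' mod q" by (simp add: mod_eq_dvd_iff)
    then show ?thesis using that(2,3) by simp
  qed
  have "inj_on ?f ?I"
  proof (rule inj_onI)
    fix u v assume uv: "u \<in> ?I" "v \<in> ?I" "?f u = ?f v"
    obtain i j k i' j' k' where eq: "u = (i, j, k)" "v = (i', j', k')" by (metis prod_cases3)
    have bounds: "int i < int p ^ (r - 1)" "int i' < int p ^ (r - 1)"
      "int j < int p ^ (s - 1)" "int j' < int p ^ (s - 1)"
      using uv(1,2) unfolding eq by (simp_all flip: of_nat_power)
    \<comment> \<open>\<open>uv(3)\<close> turns the coordinates of \<open>?f v\<close> into a
      second pair for \<open>?f u\<close>, so that uniqueness applies.\<close>
    note cu = f[of i j k] and cv = f[of i' j' k', folded eq(2), folded uv(3), unfolded eq(1)]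
    have ij: "i = i'" "j = j'"
      using coords_unique[OF cu cv] small bounds unfolding pr by blast+
    then have "c [^] (int p * int k) = c [^] (int p * int k')"
      using uv(3) g(1) h(1) H unfolding eq by (simp add: subgroup.mem_carrier)
    then have "int p ^ 2 dvd int p * int k - int p * int k'"
      using c_pow_eq_one[of "int p * int k - int p * int k'"] by (simp add: int_pow_diff)
    then have "int p * int p dvd int k * int p - int k' * int p"
      by (simp add: power2_eq_square mult.commute)
    then have "k = k'"
      by (rule small) (use uv(1,2) eq in auto)
    with ij show "u = v" by (simp add: eq)
  qed
  then have "card (?f ` ?I) = p ^ (r - 1) * (p ^ (s - 1) * p)"
    by (simp add: card_image)
  also have "\<dots> = p ^ (r + s - 1)"
    using r_pos s_pos by (simp add: power_add[symmetric] flip: power_Suc2)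
  finally have card: "card (?f ` ?I) = p ^ (r + s - 1)" .
  have "?f u \<in> H" for u
    using H z g(1) h(1) by (auto simp: case_prod_beta subgroup.m_closed subgroup_int_pow_closed)
  \<comment> \<open>Coordinates in the image are multiples of \<open>p\<close>, even after changes
    by multiples of \<open>p ^ r\<close> and \<open>p ^ s\<close>, as \<open>r\<close> and
    \<open>s\<close> are positive.\<close>
  moreover have "x \<notin> ?f ` ?I"
  proof
    assume "x \<in> ?f ` ?I"
    then obtain i' j' k' where "x = ?f (i', j', k')" by auto
    then have "int p ^ r dvd i - int i' * int p" "int p ^ s dvd j - int j' * int p"
      using coords_unique[OF x(2)] f by blast+
    then have "int p dvd i - int i' * int p" "int p dvd j - int j' * int p"
      unfolding pr using dvd_mult_left by blast+
    then have "int p dvd i - int i' * int p + int i' * int p"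
      "int p dvd j - int j' * int p + int j' * int p"
      by (meson dvd_add dvd_triv_right)+
    then show False using x(3) by simp
  qed
  ultimately have "?f ` ?I \<subset> H" using x(1) by blast
  from prime_power_card_subgroup[OF prime_p finite_G order_G H this card]
  show ?thesis using r_pos by simp
qed

section \<open>Determinants of exponent vectors\<close>

lemma not_p_square_dvd_p: "\<not> int p ^ 2 dvd int p"
  using prime_gt_1_nat[OF prime_p] by (auto simp: power2_eq_square dest: zdvd_imp_le)

text \<open>The exponents \<open>i\<close>, \<open>j\<close> refer to \<open>u\<close> and
  \<open>v\<close>, hence the factors \<open>U\<close> and \<open>V\<close>. This covers both the
  pair \<open>a\<close>, \<open>b\<close> and the pair \<open>a [^] p\<close>, \<open>b\<close>. As
  \<open>u\<close> and \<open>v\<close> centralize \<open>D\<close>,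
  \<open>commute_normal_form\<close> applies.\<close>

lemma commute_if_det:
  assumes u: "coords u U 0" "u \<otimes> c = c \<otimes> u" and v: "coords v 0 V" "v \<otimes> c = c \<otimes> v"
    and e: "e \<in> D" "u \<otimes> v = v \<otimes> u \<otimes> e"
    and x: "coords x (i * U) (j * V)" and y: "coords y (i' * U) (j' * V)"
    and det: "e [^] (i * j' - i' * j) = \<one>"
  shows "x \<otimes> y = y \<otimes> x"
proof -
  have carr: "u \<in> carrier G" "v \<in> carrier G"
    using u v coords_closed by blast+
  have form: "\<exists>d\<in>D. w = d \<otimes> (u [^] k \<otimes> v [^] l)" if "coords w (k * U) (l * V)" for w k l
  proof -
    have "coords (u [^] k \<otimes> v [^] l) (k * U) (l * V)"
      using coords_mult[OF coords_int_pow[OF u(1), of k] coords_int_pow[OF v(1), of l]] by simp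
    then show ?thesis
      using that carr coset_eq_iff[of w "u [^] k \<otimes> v [^] l"] by (simp add: coords_iff)
  qed
  obtain d d' where d: "d \<in> D" "x = d \<otimes> (u [^] i \<otimes> v [^] j)"
    and d': "d' \<in> D" "y = d' \<otimes> (u [^] i' \<otimes> v [^] j')"
    using form[OF x] form[OF y] by blast
  show ?thesis
    by (rule commute_normal_form[OF carr D_closed[OF e(1)] D_closed[OF d(1)] D_closed[OF d'(1)] e(2)
      commute_D[OF carr(1) u(2) e(1)] commute_D[OF carr(2) v(2) e(1)]
      commute_D[OF carr(1) u(2) d(1)] commute_D[OF carr(2) v(2) d(1)]
      commute_D[OF carr(1) u(2) d'(1)] commute_D[OF carr(2) v(2) d'(1)]
      D_commute[OF d(1) d'(1)] det d(2) d'(2)])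
qed

text \<open>Cramer's rule: \<open>x [^] j' \<otimes> y [^] (- j)\<close> and
  \<open>x [^] (- i') \<otimes> y [^] i\<close> have the determinant in one coordinate and zero in
  the other. Suitable powers turn it into \<open>p\<close> modulo \<open>p ^ r\<close> or
  \<open>p ^ s\<close>.\<close>

lemma card_nonabelian_ge:
  assumes H: "subgroup H G" and xy: "x \<in> H" "y \<in> H" "x \<otimes> y \<noteq> y \<otimes> x"
    and x: "coords x i j" and y: "coords y i' j'" and det: "\<not> int p ^ 2 dvd i * j' - i' * j"
  shows "p ^ (r + s) \<le> card H"
proof -
  let ?\<delta> = "i * j' - i' * j"
  obtain k l where k: "?\<delta> * k + int p ^ r * l = int p"
    using prime_power_bezout[OF prime_p det] by blast
  obtain k' l' where k': "?\<delta> * k' + int p ^ s * l' = int p"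
    using prime_power_bezout[OF prime_p det] by blast
  let ?g = "(x [^] j' \<otimes> y [^] (- j)) [^] k" and ?h = "(x [^] (- i') \<otimes> y [^] i) [^] k'"
  have "coords ?g (k * (j' * i + - j * i')) (k * (j' * j + - j * j'))"
    by (intro coords_int_pow coords_mult x y)
  then have "coords ?g (k * (j' * i + - j * i') + int p ^ r * l)
      (k * (j' * j + - j * j') + int p ^ s * 0)"
    by (rule coords_cong)
  moreover have "k * (j' * i + - j * i') + int p ^ r * l = int p"
    using k by (simp add: algebra_simps)
  ultimately have g: "coords ?g (int p) 0" by (simp add: mult.commute)
  have "coords ?h (k' * (- i' * i + i * i')) (k' * (- i' * j + i * j'))"
    by (intro coords_int_pow coords_mult x y)
  then have "coords ?h (k' * (- i' * i + i * i') + int p ^ r * 0)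
      (k' * (- i' * j + i * j') + int p ^ s * l')"
    by (rule coords_cong)
  moreover have "k' * (- i' * j + i * j') + int p ^ s * l' = int p"
    using k' by (simp add: algebra_simps)
  ultimately have h: "coords ?h 0 (int p)" by (simp add: mult.commute)
  have mem: "?g \<in> H" "?h \<in> H"
    using H xy by (intro subgroup_int_pow_closed subgroup.m_closed; simp)+
  note bound = card_subgroup_ge[OF H cp_mem_nonabelian[OF H xy] mem(1) g mem(2) h]
  \<comment> \<open>One of \<open>x\<close> and \<open>y\<close> has a coordinate prime to
    \<open>p\<close>, since otherwise \<open>p ^ 2\<close> would divide the determinant.\<close>
  show ?thesis
  proof (cases "int p dvd i \<and> int p dvd j")
    case True
    have "\<not> (int p dvd i' \<and> int p dvd j')"
    proof
      assume "int p dvd i' \<and> int p dvd j'"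
      then have "int p * int p dvd i * j'" "int p * int p dvd i' * j"
        using True mult_dvd_mono by blast+
      then show False using det by (simp add: power2_eq_square)
    qed
    then show ?thesis using bound[OF xy(2) y] by blast
  next
    case False
    then show ?thesis using bound[OF xy(1) x] by blast
  qed
qed

section \<open>Reduction of exponents and the case of central \<open>c\<close>\<close>

lemma int_pow_reduce:
  assumes g: "g \<in> carrier G" "\<exists>k::int. g [^] (N::int) = c [^] (k * int p)"
  shows "\<exists>k. g [^] (i::int) = g [^] (i mod N) \<otimes> c [^] (int p * k)"
proof -
  obtain k where k: "g [^] N = c [^] (k * int p)" using g(2) by blast
  have "g [^] (i mod N + N * (i div N)) = g [^] (i mod N) \<otimes> (g [^] N) [^] (i div N)"
    by (simp only: int_pow_mult[OF g(1)] int_pow_pow[OF g(1)])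
  also have "\<dots> = g [^] (i mod N) \<otimes> c [^] (int p * (k * (i div N)))"
    by (simp add: k int_pow_pow mult.assoc mult.left_commute)
  finally show ?thesis by auto
qed

lemma c_pow_mod: "c [^] (k::int) = c [^] (k mod int p ^ 2)"
proof -
  have "int p ^ 2 dvd k mod int p ^ 2 - k"
    by (metis mod_eq_dvd_iff mod_mod_trivial)
  then show ?thesis
    using int_pow_eq[of c k "k mod int p ^ 2"] ord_c by simp
qed

lemma cp_pow_mod: "c [^] (int p * k) = c [^] (int p * (k mod int p))"
proof -
  have "int p * k mod int p ^ 2 = int p * (k mod int p)"
    by (simp only: power2_eq_square mult_mod_right)
  then show ?thesis
    using c_pow_mod[of "int p * k"] by simp
qed

theorem class_A_central:
  assumes "a \<otimes> c = c \<otimes> a" "b \<otimes> c = c \<otimes> b"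
  shows "class_A p 3 G"
proof -
  let ?v = "b [^] int p"
  let ?S = "{c [^] (int p * k) \<otimes> (a [^] i \<otimes> ?v [^] j) | (k::int) (i::int) (j::int). True}"
  let ?E = "generate G {a, ?v}"
  \<comment> \<open>With \<open>?v\<close> in place of \<open>b\<close> the commutator is
    \<open>c [^] p\<close>, so only multiples of \<open>p\<close> occur as exponents of
    \<open>c\<close> in \<open>?E\<close>.\<close>
  have av: "a \<otimes> ?v = ?v \<otimes> a \<otimes> c [^] int p"
    using int_pow_commutator[OF _ _ _ ab assms, of 1 "int p"] by simp
  have E: "subgroup ?E G" by (rule generate_is_subgroup) simp
  have "?E \<subseteq> ?S"
  proof
    fix x assume "x \<in> ?E"
    then show "x \<in> ?S"
    proof (induction rule: generate.induct)
      case one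
      have "\<one> = c [^] (int p * 0) \<otimes> (a [^] (0::int) \<otimes> ?v [^] (0::int))" by simp
      then show ?case by blast
    next
      case (incl h)
      have "a = c [^] (int p * 0) \<otimes> (a [^] (1::int) \<otimes> ?v [^] (0::int))"
        "?v = c [^] (int p * 0) \<otimes> (a [^] (0::int) \<otimes> ?v [^] (1::int))" by simp_all
      then show ?case using incl by blast
    next
      case (inv h)
      have "inv a = c [^] (int p * 0) \<otimes> (a [^] (-1::int) \<otimes> ?v [^] (0::int))"
        "inv ?v = c [^] (int p * 0) \<otimes> (a [^] (0::int) \<otimes> ?v [^] (-1::int))"
        by (simp_all add: int_pow_neg)
      then show ?case using inv by blast
    next
      case (eng h1 h2)
      then obtain k i j k' i' j' :: int where
        h: "h1 = c [^] (int p * k) \<otimes> (a [^] i \<otimes> ?v [^] j)"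
          "h2 = c [^] (int p * k') \<otimes> (a [^] i' \<otimes> ?v [^] j')"
        by blast
      define m where "m = - (i' * j)"
      have "h1 \<otimes> h2 = c [^] (int p * k) \<otimes> c [^] (int p * k') \<otimes>
          (a [^] (i + i') \<otimes> ?v [^] (j + j')) \<otimes> (c [^] int p) [^] (m)"
        unfolding h m_def
        using cp_central[of _ 1] cp_central[of _ k'] by (intro mult_commutator_normal_form av) simp_all
      also have "\<dots> = (c [^] int p) [^] m \<otimes> (c [^] (int p * k) \<otimes> c [^] (int p * k') \<otimes>
          (a [^] (i + i') \<otimes> ?v [^] (j + j')))"
        using cp_central[of "c [^] (int p * k) \<otimes> c [^] (int p * k') \<otimes>
          (a [^] (i + i') \<otimes> ?v [^] (j + j'))" "m"] by (simp add: int_pow_pow)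
      also have "\<dots> = c [^] (int p * (m + k + k')) \<otimes> (a [^] (i + i') \<otimes> ?v [^] (j + j'))"
        by (simp add: int_pow_pow m_assoc int_pow_mult distrib_left)
      finally show ?case by blast
    qed
  qed
  let ?f = "\<lambda>(k, i, j). c [^] (int p * int k) \<otimes> (a [^] int i \<otimes> ?v [^] int j)"
  let ?I = "{..<p} \<times> {..<p ^ r} \<times> {..<p ^ (s - 1)}"
  have "?S \<subseteq> ?f ` ?I"
  proof
    fix x assume "x \<in> ?S"
    then obtain k i j :: int where x: "x = c [^] (int p * k) \<otimes> (a [^] i \<otimes> ?v [^] j)" by blast
    define i' j' where "i' = i mod int p ^ r" and "j' = j mod int p ^ (s - 1)"
    \<comment> \<open>The exponents of \<open>?v\<close> are needed only below
      \<open>p ^ (s - 1)\<close>; this offsets the factor \<open>p\<close> from the powers of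
      \<open>c [^] p\<close>.\<close>
    have "?v [^] (int p ^ (s - 1)) = b [^] (int p ^ s)"
      using s_pos by (simp add: int_pow_pow power_eq_if)
    then have "\<exists>k::int. ?v [^] (int p ^ (s - 1)) = c [^] (k * int p)"
      using b_pow by simp
    then obtain l l' where l: "a [^] i = a [^] i' \<otimes> c [^] (int p * l)"
      "?v [^] j = ?v [^] j' \<otimes> c [^] (int p * l')"
      using int_pow_reduce[of a "int p ^ r" i] int_pow_reduce[of ?v "int p ^ (s - 1)" j] a_pow
      unfolding i'_def j'_def by auto
    define k' where "k' = (k + l + l') mod int p"
    have "x = c [^] (int p * k) \<otimes> (a [^] i' \<otimes> (c [^] (int p * l) \<otimes> ?v [^] j') \<otimes> c [^] (int p * l'))"
      unfolding x l by (simp add: m_assoc)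
    also have "c [^] (int p * l) \<otimes> ?v [^] j' = ?v [^] j' \<otimes> c [^] (int p * l)"
      by (rule cp_central[symmetric]) simp
    also have "c [^] (int p * k) \<otimes> (a [^] i' \<otimes> (?v [^] j' \<otimes> c [^] (int p * l)) \<otimes> c [^] (int p * l'))
        = c [^] (int p * k) \<otimes> (a [^] i' \<otimes> ?v [^] j' \<otimes> c [^] (int p * (l + l')))"
      by (simp add: m_assoc int_pow_mult distrib_left)
    also have "\<dots> = c [^] (int p * (k + l + l')) \<otimes> (a [^] i' \<otimes> ?v [^] j')"
      using cp_central[of "a [^] i' \<otimes> ?v [^] j'" "l + l'"]
      by (simp add: m_assoc[symmetric] int_pow_mult distrib_left)
    also have "\<dots> = c [^] (int p * k') \<otimes> (a [^] i' \<otimes> ?v [^] j')"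
      unfolding k'_def by (simp only: cp_pow_mod[of "k + l + l'"])
    finally have "x = ?f (nat k', nat i', nat j')"
      using p_pos by (simp add: k'_def i'_def j'_def)
    moreover have "(nat k', nat i', nat j') \<in> ?I"
      using p_pos by (auto simp: k'_def i'_def j'_def nat_less_iff)
    ultimately show "x \<in> ?f ` ?I" by blast
  qed
  with \<open>?E \<subseteq> ?S\<close> have "card ?E \<le> card (?f ` ?I)"
    by (intro card_mono) auto
  also have "\<dots> \<le> card ?I" by (rule card_image_le) simp
  also have "\<dots> = p ^ (r + s)"
    using s_pos by (cases s) (simp_all add: power_add)
  finally have card: "card ?E \<le> p ^ (r + s)" .
  have "a \<otimes> ?v \<noteq> ?v \<otimes> a"
  proof
    assume "a \<otimes> ?v = ?v \<otimes> a"
    then have "c [^] int p = \<one>" using av by simp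
    then show False using c_pow_eq_one not_p_square_dvd_p by blast
  qed
  moreover have "a \<in> ?E" "?v \<in> ?E" by (auto intro: generate.incl)
  moreover have "p ^ (r + s) \<le> card H"
    if H: "subgroup H G" "x \<in> H" "y \<in> H" "x \<otimes> y \<noteq> y \<otimes> x" for H x y
  proof -
    obtain i j i' j' where ij: "coords x i j" "coords y i' j'"
      using coords_exist H subgroup.mem_carrier by metis
    \<comment> \<open>Otherwise \<open>c\<close> raised to the determinant would be trivial and
      \<open>x\<close> and \<open>y\<close> would commute.\<close>
    have "\<not> int p ^ 2 dvd i * j' - i' * j"
      using commute_if_det[OF coords_generators(1) assms(1) coords_generators(2) assms(2) _ ab,
          of x i j y i' j'] c_pow_D[of 1] c_pow_eq_one ij H(4) by auto
    then show ?thesis using card_nonabelian_ge[OF H ij] by blast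
  qed
  ultimately show ?thesis
    using class_A_I[OF prime_p finite_G order_G _ E, of a ?v] card by (simp add: numeral_3_eq_3)
qed

section \<open>The case in which \<open>b\<close> centralizes \<open>c\<close> and \<open>a\<close>
  does not\<close>

lemma two_le_s:
  assumes "b \<otimes> c = c \<otimes> b"
  shows "2 \<le> s"
proof (rule ccontr)
  assume "\<not> 2 \<le> s"
  then have "s = 1" using s_pos by simp
  then obtain k :: int where k: "b [^] int p = c [^] (int p * k)"
    using b_pow by (auto simp: mult.commute)
  have ba: "b \<otimes> a = a \<otimes> b \<otimes> inv c"
    unfolding ab by (simp add: m_assoc)
  have "b \<otimes> inv c = inv c \<otimes> b"
    using commute_int_pow_right[OF abc_closed(2,3) assms, of "-1"] by (simp add: int_pow_neg)
  then have "b [^] int p \<otimes> a = a \<otimes> b [^] int p \<otimes> inv c [^] int p"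
    by (intro int_pow_commutator_left ba) simp_all
  moreover have "b [^] int p \<otimes> a = a \<otimes> b [^] int p"
    unfolding k by (rule cp_central[symmetric]) simp
  ultimately have "c [^] int p = \<one>"
    by (simp add: int_pow_inv)
  then show False
    using c_pow_eq_one not_p_square_dvd_p by blast
qed

text \<open>The commutator of \<open>c\<close> and \<open>a\<close> is a power of the central
  \<open>c [^] p\<close>, so it disappears when \<open>a\<close> is raised to the power
  \<open>p\<close>. Both facts make the determinant criterion available for \<open>a [^] p\<close>
  and \<open>b\<close>.\<close>

lemma commutator_ap_b:
  "\<exists>k. a [^] int p \<otimes> b = b \<otimes> a [^] int p \<otimes> c [^] (int p * k)"
  and ap_c: "a [^] int p \<otimes> c = c \<otimes> a [^] int p"
proof -
  obtain k :: int where "inv a \<otimes> c \<otimes> a = c [^] (1 + k * int p)" using conj_a by blast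
  then have "c \<otimes> a = a \<otimes> c [^] (1 + k * int p)"
    by (metis abc_closed(1,3) inv_closed inv_solve_left' m_assoc m_closed int_pow_closed)
  then have ca: "c \<otimes> a = a \<otimes> c \<otimes> c [^] (int p * k)"
    by (simp add: int_pow_mult m_assoc mult.commute)
  have ce: "c \<otimes> c [^] (int p * k) = c [^] (int p * k) \<otimes> c"
    by (intro cp_central) simp
  have c_pow_a: "c [^] i \<otimes> a [^] j = a [^] j \<otimes> c [^] i \<otimes> c [^] (int p * (k * (i * j)))" for i j :: int
    using int_pow_commutator[OF _ _ _ ca ce cp_central] by (simp add: int_pow_pow mult.assoc)
  have "c [^] (int p * (k * int p)) = \<one>"
    by (simp add: c_pow_eq_one power2_eq_square)
  then show "a [^] int p \<otimes> c = c \<otimes> a [^] int p"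
    using c_pow_a[of 1 "int p"] by simp
  \<comment> \<open>Collection modulo the central powers of \<open>c [^] p\<close>: each passage of
    \<open>c\<close> past \<open>a\<close> contributes only such a power.\<close>
  have "\<exists>t. (a \<otimes> c) [^] int n = a [^] int n \<otimes> c [^] int n \<otimes> c [^] (int p * t)" for n
  proof (induction n)
    case 0
    have "(a \<otimes> c) [^] int 0 = a [^] int 0 \<otimes> c [^] int 0 \<otimes> c [^] (int p * 0)" by simp
    then show ?case by blast
  next
    case (Suc n)
    then obtain t where t: "(a \<otimes> c) [^] int n = a [^] int n \<otimes> c [^] int n \<otimes> c [^] (int p * t)"
      by blast
    have "(a \<otimes> c) [^] int (Suc n) = (a \<otimes> c) [^] int n \<otimes> (a \<otimes> c)"
      by (simp add: add.commute[of 1] int_pow_mult)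
    also have "\<dots> = a [^] int n \<otimes> c [^] int n \<otimes> (c [^] (int p * t) \<otimes> (a \<otimes> c))"
      unfolding t by (simp add: m_assoc)
    also have "c [^] (int p * t) \<otimes> (a \<otimes> c) = a \<otimes> c \<otimes> c [^] (int p * t)"
      by (rule cp_central[symmetric]) simp
    also have "a [^] int n \<otimes> c [^] int n \<otimes> (a \<otimes> c \<otimes> c [^] (int p * t))
        = a [^] int n \<otimes> (c [^] int n \<otimes> a) \<otimes> (c \<otimes> c [^] (int p * t))"
      by (simp add: m_assoc)
    also have "c [^] int n \<otimes> a = a \<otimes> c [^] int n \<otimes> c [^] (int p * (k * int n))"
      using c_pow_a[of "int n" 1] by simp
    also have "a [^] int n \<otimes> (a \<otimes> c [^] int n \<otimes> c [^] (int p * (k * int n))) \<otimes> (c \<otimes> c [^] (int p * t))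
        = (a [^] int n \<otimes> a) \<otimes> (c [^] int n \<otimes> (c [^] (int p * (k * int n)) \<otimes> c) \<otimes> c [^] (int p * t))"
      by (simp add: m_assoc)
    also have "c [^] (int p * (k * int n)) \<otimes> c = c \<otimes> c [^] (int p * (k * int n))"
      by (rule cp_central[symmetric]) simp
    also have "(a [^] int n \<otimes> a) \<otimes> (c [^] int n \<otimes> (c \<otimes> c [^] (int p * (k * int n))) \<otimes> c [^] (int p * t))
        = (a [^] int n \<otimes> a) \<otimes> (c [^] int n \<otimes> c) \<otimes> c [^] (int p * (k * int n + t))"
      by (simp add: m_assoc int_pow_mult distrib_left)
    also have "\<dots> = a [^] int (Suc n) \<otimes> c [^] int (Suc n) \<otimes> c [^] (int p * (k * int n + t))"
      by (simp add: add.commute[of 1] int_pow_mult)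
    finally show ?case by blast
  qed
  then obtain t where "(a \<otimes> c) [^] int p = a [^] int p \<otimes> c [^] int p \<otimes> c [^] (int p * t)" by blast
  then have t: "(a \<otimes> c) [^] int p = a [^] int p \<otimes> c [^] (int p * (1 + t))"
    by (simp add: m_assoc int_pow_mult distrib_left)
  \<comment> \<open>Conjugation by \<open>b\<close> takes \<open>a [^] p\<close> to
    \<open>(a \<otimes> c) [^] p\<close>, which was just expanded.\<close>
  have "inv b \<otimes> a \<otimes> b = a \<otimes> c"
    by (simp add: m_assoc inv_solve_left' ab)
  then have "inv b \<otimes> a [^] int p \<otimes> b = a [^] int p \<otimes> c [^] (int p * (1 + t))"
    using t by (simp flip: conj_int_pow)
  then have "a [^] int p \<otimes> b = b \<otimes> a [^] int p \<otimes> c [^] (int p * (1 + t))"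
    by (simp add: m_assoc inv_solve_left')
  then show "\<exists>k. a [^] int p \<otimes> b = b \<otimes> a [^] int p \<otimes> c [^] (int p * k)" by blast
qed

text \<open>The powers of \<open>x\<close> times those of \<open>c\<^sup>p\<close> are \<open>p\<^bsup>r+1\<^esup>\<close> commuting elements, so they do not
  exhaust \<open>H\<close>.\<close>

lemma card_nonabelian_ge_outer:
  assumes H: "subgroup H G" and yz: "y \<in> H" "z \<in> H" "y \<otimes> z \<noteq> z \<otimes> y"
    and x: "x \<in> H" "coords x i j" "\<not> int p dvd i"
  shows "p ^ (r + 2) \<le> card H"
proof -
  have xG: "x \<in> carrier G" using x(2) coords_closed by blast
  let ?f = "\<lambda>(k, l). x [^] int k \<otimes> c [^] (int p * int l)"
  let ?I = "{..<p ^ r} \<times> {..<p}"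
  have f: "coords (?f (k, l)) (int k * i) (int k * j)" for k l
    using coords_mult[OF coords_int_pow[OF x(2), of "int k"] coords_D[OF c_pow_D, of "int p * int l"]]
    by simp
  have "inj_on ?f ?I"
  proof (rule inj_onI)
    fix u v assume uv: "u \<in> ?I" "v \<in> ?I" "?f u = ?f v"
    obtain k l k' l' where eq: "u = (k, l)" "v = (k', l')" by (metis prod.exhaust)
    have bounds: "int k < int p ^ r" "int k' < int p ^ r"
      using uv(1,2) unfolding eq by (simp_all flip: of_nat_power)
    have "int p ^ r dvd int k * i - int k' * i"
      using coords_unique(1)[OF f[of k l] f[of k' l', folded eq(2), folded uv(3), unfolded eq(1)]] .
    then have "int p ^ r dvd (int k - int k') * i"
      by (simp add: algebra_simps)
    \<comment> \<open>As \<open>i\<close> is prime to \<open>p\<close>, the powers of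
      \<open>x\<close> with exponents below \<open>p ^ r\<close> stay distinct modulo
      \<open>D\<close>.\<close>
    moreover have "coprime (int p ^ r) i"
      using prime_p x(3) by (simp add: prime_imp_coprime)
    ultimately have "int p ^ r dvd int k - int k'"
      using coprime_dvd_mult_left_iff by blast
    then have "int k mod int p ^ r = int k' mod int p ^ r" by (simp add: mod_eq_dvd_iff)
    then have k: "k = k'" using bounds by simp
    then have "c [^] (int p * int l) = c [^] (int p * int l')"
      using uv(3) xG unfolding eq by simp
    then have "int p ^ 2 dvd int p * int l - int p * int l'"
      using c_pow_eq_one[of "int p * int l - int p * int l'"] by (simp add: int_pow_diff)
    then have "int p * int p dvd int p * (int l - int l')"
      by (simp add: power2_eq_square algebra_simps)
    then have "int p dvd int l - int l'" using p_pos by simp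
    then have "int l mod int p = int l' mod int p" by (simp add: mod_eq_dvd_iff)
    then have "l = l'" using uv(1,2) eq by simp
    with k show "u = v" by (simp add: eq)
  qed
  then have card: "card (?f ` ?I) = p ^ (r + 1)"
    by (simp add: card_image mult.commute)
  have "?f u \<in> H" for u
    using subgroup_int_pow_closed[OF H x(1)] cp_mem_nonabelian[OF H yz] subgroup.m_closed[OF H]
    by (simp add: case_prod_beta)
  moreover have "?f u \<otimes> ?f v = ?f v \<otimes> ?f u" for u v
  proof -
    have 1: "x [^] m \<otimes> (x [^] k \<otimes> c [^] (int p * l)) = x [^] k \<otimes> c [^] (int p * l) \<otimes> x [^] m"
      for m k l :: int
      using xG by (intro commute_mult commute_int_pow cp_central) auto
    have "x [^] k \<otimes> c [^] (int p * l) \<otimes> (x [^] k' \<otimes> c [^] (int p * l'))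
        = x [^] k' \<otimes> c [^] (int p * l') \<otimes> (x [^] k \<otimes> c [^] (int p * l))" for k l k' l' :: int
      using xG by (intro commute_mult 1[symmetric] cp_central) auto
    then show ?thesis by (simp add: case_prod_beta)
  qed
  then have "?f ` ?I \<noteq> H" using yz by blast
  ultimately have "?f ` ?I \<subset> H" by blast
  from prime_power_card_subgroup[OF prime_p finite_G order_G H this card]
  show ?thesis by simp
qed

theorem class_A_noncentral:
  assumes bc: "b \<otimes> c = c \<otimes> b" and ac: "a \<otimes> c \<noteq> c \<otimes> a"
  shows "class_A p (s + 1) G"
proof -
  have lower: "p ^ (r + 2) \<le> card H"
    if H: "subgroup H G" and xy: "x \<in> H" "y \<in> H" "x \<otimes> y \<noteq> y \<otimes> x" for H x y
  proof (cases "\<exists>w\<in>H. \<exists>i j. coords w i j \<and> \<not> int p dvd i")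
    case True
    then show ?thesis using card_nonabelian_ge_outer[OF H xy] by blast
  next
    \<comment> \<open>All first coordinates in \<open>H\<close> are multiples of \<open>p\<close>,
      so modulo \<open>D\<close> the elements \<open>x\<close> and \<open>y\<close> are products of
      powers of \<open>a [^] p\<close> and \<open>b\<close>, which centralize
      \<open>c\<close>.\<close>
    case False
    obtain i j i' j' where ij: "coords x i j" "coords y i' j'"
      using coords_exist subgroup.mem_carrier[OF H] xy by meson
    then obtain k k' where k: "i = int p * k" "i' = int p * k'"
      using False xy unfolding dvd_def by metis
    obtain l where l: "a [^] int p \<otimes> b = b \<otimes> a [^] int p \<otimes> c [^] (int p * l)"
      using commutator_ap_b by blast
    have ap: "coords (a [^] int p) (int p) 0"
      using coords_int_pow[OF coords_generators(1), of "int p"] by simp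
    \<comment> \<open>The determinant with respect to \<open>a [^] p\<close> and \<open>b\<close>.
      Their commutator is a power of \<open>c [^] p\<close>, so divisibility by \<open>p\<close>
      alone would already make \<open>x\<close> and \<open>y\<close> commute.\<close>
    have "\<not> int p dvd k * j' - k' * j"
    proof
      assume "int p dvd k * j' - k' * j"
      then have "int p ^ 2 dvd int p * l * (k * j' - k' * j)"
        by (auto simp: power2_eq_square)
      then have "(c [^] (int p * l)) [^] (k * j' - k' * j) = \<one>"
        using c_pow_eq_one by (simp add: int_pow_pow)
      then have "x \<otimes> y = y \<otimes> x"
        using commute_if_det[OF ap ap_c coords_generators(2) bc c_pow_D l, of x k j y k' j'] ij k
        by (simp add: mult.commute)
      then show False using xy(3) by blast
    qed
    moreover have "i * j' - i' * j = int p * (k * j' - k' * j)"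
      using k by (simp add: algebra_simps)
    ultimately have "\<not> int p ^ 2 dvd i * j' - i' * j"
      using p_pos by (simp add: power2_eq_square)
    then have "p ^ (r + s) \<le> card H" by (rule card_nonabelian_ge[OF H xy ij])
    \<comment> \<open>\<open>two_le_s\<close> makes the determinant bound at least as strong as the
      one claimed.\<close>
    moreover have "p ^ (r + 2) \<le> p ^ (r + s)"
      using two_le_s[OF bc] p_pos by (intro power_increasing) auto
    ultimately show ?thesis by simp
  qed
  \<comment> \<open>The preimage of the cyclic group generated by the coset of \<open>a\<close>,
    that is, the subgroup generated by \<open>a\<close> and \<open>c\<close>.\<close>
  let ?E = "{x. \<exists>i. coords x i 0}"
  have E: "subgroup ?E G"
  proof (rule subgroupI)
    show "?E \<subseteq> carrier G" using coords_closed by blast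
    show "?E \<noteq> {}" using coords_generators(1) by blast
    show "inv x \<in> ?E" if "x \<in> ?E" for x using that coords_inv by fastforce
    show "x \<otimes> y \<in> ?E" if "x \<in> ?E" "y \<in> ?E" for x y using that coords_mult by fastforce
  qed
  let ?f = "\<lambda>(k, i). c [^] int k \<otimes> a [^] int i"
  let ?I = "{..<p ^ 2} \<times> {..<p ^ r}"
  have "?E \<subseteq> ?f ` ?I"
  proof
    fix x assume "x \<in> ?E"
    then obtain i k :: int where x: "x = c [^] k \<otimes> a [^] i"
      unfolding coords_def D_eq by auto
    define i' where "i' = i mod int p ^ r"
    obtain l where l: "a [^] i = a [^] i' \<otimes> c [^] (int p * l)"
      using int_pow_reduce[of a "int p ^ r" i] a_pow unfolding i'_def by auto
    define k' where "k' = (k + int p * l) mod int p ^ 2"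
    have "a [^] i = c [^] (int p * l) \<otimes> a [^] i'"
      unfolding l by (rule cp_central) simp
    then have "x = c [^] (k + int p * l) \<otimes> a [^] i'"
      unfolding x by (simp add: int_pow_mult m_assoc)
    then have "x = c [^] k' \<otimes> a [^] i'"
      unfolding k'_def by (simp only: c_pow_mod[of "k + int p * l"])
    then have "x = ?f (nat k', nat i')"
      using p_pos by (simp add: k'_def i'_def)
    moreover have "(nat k', nat i') \<in> ?I"
      using p_pos by (auto simp: k'_def i'_def nat_less_iff)
    ultimately show "x \<in> ?f ` ?I" by blast
  qed
  then have "card ?E \<le> card (?f ` ?I)"
    by (intro card_mono) auto
  also have "\<dots> \<le> card ?I" by (rule card_image_le) simp
  also have "\<dots> = p ^ (r + 2)"
    by (simp add: power_add power2_eq_square mult.commute)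
  finally have card: "card ?E \<le> p ^ (r + 2)" .
  have mem: "a \<in> ?E" "c \<in> ?E"
    using coords_generators(1) coords_D[OF c_pow_D[of 1]] by auto
  \<comment> \<open>Regrouped to fit \<open>class_A_I\<close>, with \<open>e\<close> equal to
    \<open>r + 2\<close> and index exponent \<open>s\<close>.\<close>
  have order: "order G = p ^ (r + 2 + s)"
    using order_G by (simp add: ac_simps)
  show ?thesis
    by (rule class_A_I[OF prime_p finite_G order lower E mem ac card])
qed

text \<open>The commutator of \<open>b\<close> and \<open>a\<close> is \<open>inv c\<close>, which
  generates the same subgroup. The reversed order of the factors in \<open>span\<close> and
  \<open>indep\<close> is harmless because \<open>G Mod D\<close> is abelian.\<close>

lemma swap: "cyclic_derived_p_group G p s r b a (inv c)"
proof -
  have inv_c: "generate G {inv c} = generate G {c}"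
  proof -
    have "inv c [^] k = c [^] (- k)" "c [^] k = inv c [^] (- k)" for k :: int
      by (simp_all add: int_pow_inv int_pow_neg)
    then have "range (\<lambda>k::int. inv c [^] k) = range (\<lambda>k::int. c [^] k)" by blast
    then show ?thesis using generate_pow[of c] generate_pow[of "inv c"] by auto
  qed
  have conj: "\<exists>k::int. inv u \<otimes> inv c \<otimes> u = inv c [^] (1 + k * int p)"
    if u: "u \<in> carrier G" "\<exists>k::int. inv u \<otimes> c \<otimes> u = c [^] (1 + k * int p)" for u
  proof -
    obtain k :: int where k: "inv u \<otimes> c \<otimes> u = c [^] (1 + k * int p)" using u(2) by blast
    have "inv u \<otimes> inv c \<otimes> u = inv (inv u \<otimes> c \<otimes> u)"
      using u(1) by (simp add: inv_mult_group m_assoc)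
    then show ?thesis unfolding k by (metis abc_closed(3) int_pow_inv)
  qed
  have pow: "\<exists>k::int. u [^] n = inv c [^] (k * int p)"
    if k: "\<exists>k::int. u [^] n = c [^] (k * int p)" for u and n :: int
  proof -
    obtain k :: int where "u [^] n = c [^] (k * int p)" using k by blast
    then have "u [^] n = inv c [^] (- k * int p)" by (simp add: int_pow_inv int_pow_neg)
    then show ?thesis by blast
  qed
  have ba: "coords (b [^] j \<otimes> a [^] i) i j" for i j
    using coords_mult[OF coords_int_pow[OF coords_generators(2), of j]
        coords_int_pow[OF coords_generators(1), of i]] by simp
  show ?thesis
  proof unfold_locales
    show "order G = p ^ (s + r + 2)" using order_G by (simp add: add.commute)
    show "b \<otimes> a = a \<otimes> b \<otimes> inv c" unfolding ab by (simp add: m_assoc)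
    show "\<exists>(i::int) (j::int). \<exists>d\<in>derived G (carrier G). x = d \<otimes> (b [^] i \<otimes> a [^] j)"
      if "x \<in> carrier G" for x
    proof -
      obtain i j where "coords x i j" using coords_exist[OF \<open>x \<in> carrier G\<close>] by blast
      with ba[of j i] have "D #> x = D #> (b [^] j \<otimes> a [^] i)" by (simp add: coords_iff)
      then show ?thesis
        using coset_eq_iff[of x "b [^] j \<otimes> a [^] i"] \<open>x \<in> carrier G\<close> by auto
    qed
    show "int p ^ s dvd i \<and> int p ^ r dvd j"
      if "b [^] i \<otimes> a [^] j \<in> derived G (carrier G)" for i j :: int
      using coords_unique[OF ba[of i j] coords_D[OF that]] by simp
  qed (use prime_p r_pos s_pos finite_G ord_c derived_eq inv_c conj conj_a conj_b pow a_pow b_pow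
      in \<open>auto simp: ord_inv\<close>)
qed

end

section \<open>The abelianization of \<open>M\<^sub>p(n,m,1)\<close>\<close>

definition word_eval :: "('a, 'b) monoid_scheme \<Rightarrow> ('x \<Rightarrow> 'a) \<Rightarrow> 'x word \<Rightarrow> 'a" where
  "word_eval A f u =
    foldr (\<lambda>(x, e) y. (if e then f x else inv\<^bsub>A\<^esub> f x) \<otimes>\<^bsub>A\<^esub> y) u \<one>\<^bsub>A\<^esub>"

context group
begin

context
  fixes f :: "'x \<Rightarrow> 'a"
  assumes f_closed [simp]: "\<And>x. f x \<in> carrier G"
begin

lemma word_eval_closed [simp]: "word_eval G f u \<in> carrier G"
  by (induction u) (auto simp: word_eval_def)

lemma word_eval_append: "word_eval G f (u @ v) = word_eval G f u \<otimes> word_eval G f v"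
proof (induction u)
  case Nil
  then show ?case using word_eval_closed[of v] by (simp add: word_eval_def)
next
  case (Cons l u)
  have "word_eval G f (l # w) = (if snd l then f (fst l) else inv f (fst l)) \<otimes> word_eval G f w" for w
    by (simp add: word_eval_def case_prod_beta)
  then show ?case using Cons by (simp add: m_assoc)
qed

lemma word_eval_replicate: "word_eval G f (replicate k (x, True)) = f x [^] k"
proof (induction k)
  case 0
  show ?case by (simp add: word_eval_def)
next
  case (Suc k)
  then show ?case by (simp add: word_eval_def group_commutes_pow[OF HOL.refl])
qed

lemma word_eval_word_eq:
  assumes "word_eq R u v" and "\<And>u v. (u, v) \<in> R \<Longrightarrow> word_eval G f u = word_eval G f v"
  shows "word_eval G f u = word_eval G f v"
  using assms(1)
  by (induction rule: word_eq.induct) (use assms(2) in \<open>auto simp: word_eval_append, simp add: word_eval_def\<close>)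

text \<open>Von Dyck's theorem. The map evaluates a chosen representative word; the choice is
  immaterial since evaluation respects \<open>word_eq\<close>.\<close>

lemma presented_group_hom:
  assumes "\<And>u v. (u, v) \<in> R \<Longrightarrow> word_eval G f u = word_eval G f v"
  shows "\<exists>h\<in>hom (presented_group R) G. \<forall>u. h (word_class R u) = word_eval G f u"
proof -
  define h where "h X = word_eval G f (SOME u. X = word_class R u)" for X
  have h: "h (word_class R u) = word_eval G f u" for u
  proof -
    have "word_class R u = word_class R (SOME u'. word_class R u = word_class R u')"
      by (rule someI) (rule HOL.refl)
    then have "word_eq R u (SOME u'. word_class R u = word_class R u')"
      by (simp only: word_class_eq_iff)
    then show ?thesis
      unfolding h_def using word_eval_word_eq assms by metis
  qed
  moreover have "h \<in> hom (presented_group R) G"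
  proof (rule homI)
    show "h X \<in> carrier G" if "X \<in> carrier (presented_group R)" for X
      by (simp add: h_def)
    show "h (X \<otimes>\<^bsub>presented_group R\<^esub> Y) = h X \<otimes> h Y"
      if XY: "X \<in> carrier (presented_group R)" "Y \<in> carrier (presented_group R)" for X Y
    proof -
      obtain u v where "X = word_class R u" "Y = word_class R v"
        using XY by (auto simp: presented_group_def)
      then show ?thesis by (simp add: presented_group_mult h word_eval_append)
    qed
  qed
  ultimately show ?thesis by blast
qed

end

end

text \<open>\<open>gen_a\<close> and \<open>gen_b\<close> go to generators of the two factors and
  \<open>gen_c\<close> to the identity; the commutator relations hold because \<open>A\<close> is
  abelian. Surjectivity later keeps the exponents modulo the derived subgroup from
  collapsing.\<close>

lemma M_group_abelianization:
  fixes p n m :: nat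
  assumes "prime p"
  defines "A \<equiv> integer_mod_group (p ^ n) \<times>\<times> integer_mod_group (p ^ m)"
  shows "\<exists>h\<in>hom (M_group p n m) A. h ` carrier (M_group p n m) = carrier A"
proof -
  interpret A: comm_group A
    unfolding A_def
    by (rule group.group_comm_groupI) (auto simp: DirProd_group add.commute)
  have p0: "0 < p" using assms(1) prime_gt_0_nat by blast
  \<comment> \<open>The residue of \<open>1\<close> is taken because \<open>1\<close> itself is
    outside the carrier of a factor whose exponent is \<open>0\<close>.\<close>
  define f where "f x = (case x of gen_a \<Rightarrow> (1 mod int (p ^ n), 0) | gen_b \<Rightarrow> (0, 1 mod int (p ^ m))
    | gen_c \<Rightarrow> (0, 0))" for x
  have f: "f x \<in> carrier A" for x
    using p0 by (cases x) (auto simp: f_def A_def DirProd_def carrier_integer_mod_group)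
  have pow: "(x, y) [^]\<^bsub>A\<^esub> k = (int k * x mod int (p ^ n), int k * y mod int (p ^ m))"
    for x y and k :: nat
    by (induction k) (simp_all add: A_def mod_add_right_eq algebra_simps)
  have comm: "word_eval A f (word_commutator (gen_word x) (gen_word y)) = \<one>\<^bsub>A\<^esub>" for x y
  proof -
    have "inv\<^bsub>A\<^esub> f x \<otimes>\<^bsub>A\<^esub> (inv\<^bsub>A\<^esub> f y \<otimes>\<^bsub>A\<^esub> (f x \<otimes>\<^bsub>A\<^esub> f y)) = \<one>\<^bsub>A\<^esub>"
      using f A.m_comm[of "f x" "f y"] by (simp add: A.inv_solve_left')
    then show ?thesis
      using f by (simp add: word_commutator_def word_inv_def word_eval_def)
  qed
  have "word_eval A f u = word_eval A f v" if "(u, v) \<in> M_relations p n m" for u v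
  proof -
    have "word_eval A f [] = \<one>\<^bsub>A\<^esub>" "word_eval A f (gen_word gen_c) = \<one>\<^bsub>A\<^esub>"
      "f gen_a [^]\<^bsub>A\<^esub> (p ^ n) = \<one>\<^bsub>A\<^esub>" "f gen_b [^]\<^bsub>A\<^esub> (p ^ m) = \<one>\<^bsub>A\<^esub>" "f gen_c [^]\<^bsub>A\<^esub> p = \<one>\<^bsub>A\<^esub>"
      using f[of gen_c] by (auto simp: word_eval_def f_def pow) (auto simp: A_def)
    then show ?thesis
      using that comm f unfolding M_relations_def
      by (auto simp: A.word_eval_replicate)
  qed
  then obtain h where h: "h \<in> hom (M_group p n m) A"
    "\<And>u. h (word_class (M_relations p n m) u) = word_eval A f u"
    using A.presented_group_hom[of f "M_relations p n m"] f unfolding M_group_def by blast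
  have "carrier A \<subseteq> h ` carrier (M_group p n m)"
  proof
    fix y assume "y \<in> carrier A"
    then obtain i j where y: "y = (int i, int j)" "i < p ^ n" "j < p ^ m"
      using p0 by (auto simp: A_def DirProd_def carrier_integer_mod_group elim!: nonneg_int_cases)
    have "h (word_class (M_relations p n m) (replicate i (gen_a, True) @ replicate j (gen_b, True))) = y"
    proof -
      have "int i < int p ^ n" "int j < int p ^ m"
        using y(2,3) by (simp_all flip: of_nat_power)
      then have "f gen_a [^]\<^bsub>A\<^esub> i = (int i, 0)" "f gen_b [^]\<^bsub>A\<^esub> j = (0, int j)"
        by (simp_all add: f_def pow mod_mult_right_eq)
      then show ?thesis
        unfolding h(2) using f y \<open>int i < int p ^ n\<close> \<open>int j < int p ^ m\<close>
        by (simp add: A.word_eval_append A.word_eval_replicate) (simp add: A_def)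
    qed
    then show "y \<in> h ` carrier (M_group p n m)"
      unfolding M_group_def presented_group_def by auto
  qed
  then show ?thesis using h(1) hom_carrier[OF h(1)] by blast
qed

section \<open>Generation and Frattini subgroups\<close>

context group
begin

lemma commute_central_pow:
  assumes carr: "u \<in> carrier G" "v \<in> carrier G" "e \<in> carrier G"
    and e: "u \<otimes> e = e \<otimes> u" "v \<otimes> e = e \<otimes> v"
  shows "e [^] (t::int) \<otimes> (e [^] (k::int) \<otimes> e [^] (k'::int) \<otimes> (u [^] (i::int) \<otimes> v [^] (j::int)))
    = e [^] k \<otimes> e [^] k' \<otimes> (u [^] i \<otimes> v [^] j) \<otimes> e [^] t"
proof -
  have "e [^] t \<otimes> e [^] k = e [^] k \<otimes> e [^] t" for k :: int
    using carr commute_int_pow[OF carr(3,3)] by simp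
  moreover have "e [^] t \<otimes> u [^] i = u [^] i \<otimes> e [^] t" "e [^] t \<otimes> v [^] j = v [^] j \<otimes> e [^] t"
    using carr commute_int_pow[of e _ t] e by simp_all
  ultimately show ?thesis
    using carr commute_mult[of "e [^] t"] by simp
qed

text \<open>Elements of this form are closed under multiplication, since collecting powers of
  \<open>u\<close> to the left costs only powers of the central \<open>e\<close>.\<close>

lemma two_generator_normal_form:
  assumes gen: "generate G {u, v} = carrier G"
    and carr: "u \<in> carrier G" "v \<in> carrier G" "e \<in> carrier G"
    and uv: "u \<otimes> v = v \<otimes> u \<otimes> e" and e: "u \<otimes> e = e \<otimes> u" "v \<otimes> e = e \<otimes> v"
    and x: "x \<in> carrier G"
  shows "\<exists>(k::int) (i::int) (j::int). x = e [^] k \<otimes> (u [^] i \<otimes> v [^] j)"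
  using x unfolding gen[symmetric]
proof (induction rule: generate.induct)
  case one
  have "\<one> = e [^] (0::int) \<otimes> (u [^] (0::int) \<otimes> v [^] (0::int))" by simp
  then show ?case by blast
next
  case (incl h)
  have "u = e [^] (0::int) \<otimes> (u [^] (1::int) \<otimes> v [^] (0::int))"
    "v = e [^] (0::int) \<otimes> (u [^] (0::int) \<otimes> v [^] (1::int))"
    using carr by simp_all
  then show ?case using incl by blast
next
  case (inv h)
  have "inv u = e [^] (0::int) \<otimes> (u [^] (-1::int) \<otimes> v [^] (0::int))"
    "inv v = e [^] (0::int) \<otimes> (u [^] (0::int) \<otimes> v [^] (-1::int))"
    using carr by (simp_all add: int_pow_neg)
  then show ?case using inv by blast
next
  case (eng h1 h2)
  then obtain k i j k' i' j' :: int where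
    h: "h1 = e [^] k \<otimes> (u [^] i \<otimes> v [^] j)" "h2 = e [^] k' \<otimes> (u [^] i' \<otimes> v [^] j')"
    by blast
  have "h1 \<otimes> h2 = e [^] k \<otimes> e [^] k' \<otimes> (u [^] (i + i') \<otimes> v [^] (j + j')) \<otimes> e [^] (- (i' * j))"
    unfolding h using carr e
    by (intro mult_commutator_normal_form uv commute_int_pow_right) auto
  also have "\<dots> = e [^] (- (i' * j)) \<otimes> (e [^] k \<otimes> e [^] k' \<otimes> (u [^] (i + i') \<otimes> v [^] (j + j')))"
    by (rule commute_central_pow[OF carr e, symmetric])
  also have "\<dots> = e [^] (- (i' * j)) \<otimes> e [^] k \<otimes> e [^] k' \<otimes> (u [^] (i + i') \<otimes> v [^] (j + j'))"
    using carr by (simp add: m_assoc)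
  also have "\<dots> = e [^] (- (i' * j) + k + k') \<otimes> (u [^] (i + i') \<otimes> v [^] (j + j'))"
    using carr by (simp only: int_pow_mult)
  finally show ?case by blast
qed

text \<open>The normal forms of \<open>x \<otimes> y\<close> and \<open>y \<otimes> x\<close> share
  the factor \<open>?w\<close> and differ only in the power of \<open>e\<close>.\<close>

lemma two_generator_derived:
  assumes gen: "generate G {u, v} = carrier G"
    and carr: "u \<in> carrier G" "v \<in> carrier G" "e \<in> carrier G"
    and uv: "u \<otimes> v = v \<otimes> u \<otimes> e" and e: "u \<otimes> e = e \<otimes> u" "v \<otimes> e = e \<otimes> v"
  shows "derived G (carrier G) \<subseteq> generate G {e}"
proof -
  have comm: "x \<otimes> y \<otimes> inv x \<otimes> inv y \<in> generate G {e}"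
    if xy: "x \<in> carrier G" "y \<in> carrier G" for x y
  proof -
    obtain k i j k' i' j' :: int where
      h: "x = e [^] k \<otimes> (u [^] i \<otimes> v [^] j)" "y = e [^] k' \<otimes> (u [^] i' \<otimes> v [^] j')"
      using two_generator_normal_form[OF assms] xy by metis
    let ?w = "e [^] k \<otimes> e [^] k' \<otimes> (u [^] (i + i') \<otimes> v [^] (j + j'))"
    have w: "?w \<in> carrier G" using carr by simp
    have 1: "x \<otimes> y = ?w \<otimes> e [^] (- (i' * j))"
      unfolding h using carr e
      by (intro mult_commutator_normal_form uv commute_int_pow_right) auto
    have "y \<otimes> x = e [^] k' \<otimes> e [^] k \<otimes> (u [^] (i' + i) \<otimes> v [^] (j' + j)) \<otimes> e [^] (- (i * j'))"
      unfolding h using carr e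
      by (intro mult_commutator_normal_form uv commute_int_pow_right) auto
    then have 2: "y \<otimes> x = ?w \<otimes> e [^] (- (i * j'))"
      using carr by (simp add: add.commute flip: int_pow_mult)
    have ew: "?w \<otimes> e [^] t = e [^] t \<otimes> ?w" for t :: int
      by (rule commute_central_pow[OF carr e, symmetric])
    have "x \<otimes> y \<otimes> inv x \<otimes> inv y = (x \<otimes> y) \<otimes> inv (y \<otimes> x)"
      using xy by (simp add: inv_mult_group m_assoc)
    also have "\<dots> = e [^] (- (i' * j)) \<otimes> (?w \<otimes> (inv ?w \<otimes> inv (e [^] (- (i * j')))))"
      unfolding 1 2 ew using carr by (simp only: inv_mult_group m_assoc m_closed int_pow_closed inv_closed)
    also have "?w \<otimes> (inv ?w \<otimes> inv (e [^] (- (i * j')))) = inv (e [^] (- (i * j')))"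
      using carr(3) w by (simp only: m_assoc[symmetric] inv_closed int_pow_closed r_inv l_one)
    also have "e [^] (- (i' * j)) \<otimes> inv (e [^] (- (i * j'))) = e [^] (- (i' * j) - - (i * j'))"
      using carr by (simp only: int_pow_diff)
    finally show ?thesis using carr(3) by (auto simp: generate_pow)
  qed
  show ?thesis
    unfolding derived_def using carr comm
    by (intro generate_subgroup_incl generate_is_subgroup) auto
qed

section \<open>Frattini subgroups and non-generators\<close>

lemma proper_subgroup_le_maximal:
  assumes fin: "finite (carrier G)" and H: "subgroup H G" "H \<noteq> carrier G"
  shows "\<exists>M. maximal_subgroup M G \<and> H \<subseteq> M"
proof -
  let ?S = "{K. subgroup K G \<and> K \<noteq> carrier G \<and> H \<subseteq> K}"
  have "?S \<subseteq> Pow (carrier G)" using subgroup.subset by blast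
  then have "finite ?S" using fin finite_subset by blast
  moreover have "H \<in> ?S" using H by blast
  ultimately obtain M where M: "M \<in> ?S" "\<And>K. K \<in> ?S \<Longrightarrow> M \<subseteq> K \<Longrightarrow> K = M"
    using finite_has_maximal2[of ?S H] by (metis (no_types, lifting))
  then have "maximal_subgroup M G"
    unfolding maximal_subgroup_def by blast
  then show ?thesis using M by blast
qed

lemma frattini_subgroup: "subgroup (frattini G) G"
proof -
  \<comment> \<open>The extra member keeps the family nonempty even without maximal
    subgroups.\<close>
  have "frattini G = \<Inter> (insert (carrier G) {M. maximal_subgroup M G})"
    by (simp add: frattini_def)
  also have "subgroup \<dots> G"
    by (rule subgroups_Inter) (auto simp: maximal_subgroup_def subgroup_self)
  finally show ?thesis .
qed

text \<open>A proper \<open>H\<close> lies in a maximal subgroup, which also contains the Frattini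
  subgroup and hence every product \<open>f \<otimes> h\<close>.\<close>

lemma frattini_nongenerators:
  assumes fin: "finite (carrier G)" and H: "subgroup H G"
    and gen: "\<And>x. x \<in> carrier G \<Longrightarrow> \<exists>f\<in>frattini G. \<exists>h\<in>H. x = f \<otimes> h"
  shows "H = carrier G"
proof (rule ccontr)
  assume "H \<noteq> carrier G"
  then obtain M where M: "maximal_subgroup M G" "H \<subseteq> M"
    using proper_subgroup_le_maximal[OF fin H] by blast
  then have "subgroup M G" "M \<noteq> carrier G" by (auto simp: maximal_subgroup_def)
  moreover have "frattini G \<subseteq> M" using M(1) by (auto simp: frattini_def)
  ultimately have "x \<in> M" if "x \<in> carrier G" for x
    using gen[OF that] M(2) subgroup.m_closed[of M G] by blast
  then show False
    using \<open>M \<noteq> carrier G\<close> subgroup.subset[OF \<open>subgroup M G\<close>] by blast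
qed

end

section \<open>Exponents in a quotient, by counting\<close>

context group_hom
begin

context
  fixes a b :: 'a and D :: "'a set" and N M :: nat
  assumes surj: "h ` carrier G = carrier H" and card_H: "card (carrier H) = N * M"
    and N: "0 < N" and M: "0 < M" and ab: "a \<in> carrier G" "b \<in> carrier G"
    and D: "subgroup D G" "\<And>d. d \<in> D \<Longrightarrow> h d = \<one>\<^bsub>H\<^esub>"
    and span: "\<And>x. x \<in> carrier G \<Longrightarrow> \<exists>(i::int) (j::int). \<exists>d\<in>D. x = d \<otimes> (a [^] i \<otimes> b [^] j)"
    and pow: "a [^] int N \<in> D" "b [^] int M \<in> D"
begin

text \<open>The products with reduced exponents already cover the \<open>N * M\<close> elements of
  the image, so they are distinct there, and only the pair \<open>(0, 0)\<close> gives the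
  identity.\<close>

lemma exponents_dvd:
  assumes "h (a [^] (i::int) \<otimes> b [^] (j::int)) = \<one>\<^bsub>H\<^esub>"
  shows "int N dvd i \<and> int M dvd j"
proof -
  have red: "h g [^]\<^bsub>H\<^esub> i = h g [^]\<^bsub>H\<^esub> int (nat (i mod int K))"
    if g: "g \<in> carrier G" "g [^] int K \<in> D" "0 < K" for g K and i :: int
  proof -
    have "h g [^]\<^bsub>H\<^esub> int K = \<one>\<^bsub>H\<^esub>"
      using D(2)[OF g(2)] g(1) by (simp add: hom_int_pow)
    then have "h g [^]\<^bsub>H\<^esub> (int K * (i div int K)) = \<one>\<^bsub>H\<^esub>"
      using H.int_pow_pow[OF hom_closed[OF g(1)], of "int K" "i div int K"] by simp
    then have "h g [^]\<^bsub>H\<^esub> (i mod int K + int K * (i div int K)) = h g [^]\<^bsub>H\<^esub> (i mod int K)"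
      using g(1) by (simp only: H.int_pow_mult hom_closed H.r_one H.int_pow_closed)
    then show ?thesis using g(3) by simp
  qed
  let ?f = "\<lambda>(i, j). h a [^]\<^bsub>H\<^esub> int i \<otimes>\<^bsub>H\<^esub> h b [^]\<^bsub>H\<^esub> int j" and ?I = "{..<N} \<times> {..<M}"
  have val: "h (a [^] i \<otimes> b [^] j) = ?f (nat (i mod int N), nat (j mod int M))" for i j :: int
    using ab red[OF ab(1) pow(1) N, of i] red[OF ab(2) pow(2) M, of j] by (simp add: hom_int_pow)
  have mem: "(nat (i mod int N), nat (j mod int M)) \<in> ?I" for i j :: int
    using N M by (simp add: nat_less_iff)
  have "carrier H \<subseteq> ?f ` ?I"
  proof
    fix y assume "y \<in> carrier H"
    then obtain x where x: "x \<in> carrier G" "y = h x" using surj by blast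
    then obtain i j :: int and d where d: "d \<in> D" "x = d \<otimes> (a [^] i \<otimes> b [^] j)"
      using span by blast
    have "d \<in> carrier G" by (rule subgroup.mem_carrier[OF D(1) d(1)])
    then have "y = h (a [^] i \<otimes> b [^] j)"
      using x(2) d ab D(2) by simp
    then show "y \<in> ?f ` ?I" using val mem by blast
  qed
  moreover have "?f ` ?I \<subseteq> carrier H" using ab by auto
  ultimately have "card (?f ` ?I) = card ?I" using card_H by (simp add: subset_antisym)
  then have inj: "inj_on ?f ?I" by (intro eq_card_imp_inj_on) auto
  have "?f (nat (i mod int N), nat (j mod int M)) = ?f (0, 0)"
    using assms val[of i j] by simp
  moreover have "(0, 0) \<in> ?I" using N M by simp
  ultimately have "(nat (i mod int N), nat (j mod int M)) = (0, 0)"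
    using inj_onD[OF inj] mem[of i j] by blast
  then have "i mod int N = 0" "j mod int M = 0"
    using N M by (simp_all add: nat_eq_iff)
  then show ?thesis by (simp add: dvd_eq_mod_eq_0)
qed

text \<open>A kernel element has exponents divisible by \<open>N\<close> and \<open>M\<close>, and
  \<open>pow\<close> puts such powers into \<open>D\<close>.\<close>

lemma kernel_eq: "kernel G H h = D"
proof
  show "D \<subseteq> kernel G H h"
    using D subgroup.mem_carrier by (auto simp: kernel_def)
  show "kernel G H h \<subseteq> D"
  proof
    fix x assume "x \<in> kernel G H h"
    then have x: "x \<in> carrier G" "h x = \<one>\<^bsub>H\<^esub>" by (auto simp: kernel_def)
    then obtain i j :: int and d where d: "d \<in> D" "x = d \<otimes> (a [^] i \<otimes> b [^] j)"
      using span by blast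
    have "d \<in> carrier G" by (rule subgroup.mem_carrier[OF D(1) d(1)])
    then have "h (a [^] i \<otimes> b [^] j) = \<one>\<^bsub>H\<^esub>"
      using x(2) d ab D(2) by simp
    then obtain k l where "i = int N * k" "j = int M * l"
      using exponents_dvd by (metis dvdE)
    then have "a [^] i = (a [^] int N) [^] k" "b [^] j = (b [^] int M) [^] l"
      using ab by (simp_all add: G.int_pow_pow)
    then have "a [^] i \<in> D" "b [^] j \<in> D"
      using G.subgroup_int_pow_closed[OF D(1)] pow by simp_all
    then show "x \<in> D"
      using d subgroup.m_closed[OF D(1)] by simp
  qed
qed

lemma order_eq: "order G = N * M * card D"
proof -
  have "card (carrier (G Mod D)) = N * M"
    using iso_same_card[OF FactGroup_iso[OF surj]] card_H by (simp add: kernel_eq)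
  then show ?thesis
    using G.lagrange[OF D(1)] by (simp add: FactGroup_def)
qed

end

end

section \<open>Groups with a characteristic matrix\<close>

text \<open>Class two of the quotient \<open>Q\<close> shows that \<open>F\<close> and
  \<open>c\<close> generate \<open>D\<close>, and non-generators then remove \<open>F\<close>. The
  surjection from \<open>M_group p n m\<close> supplies the order of \<open>G\<close> and the
  independence of \<open>a\<close> and \<open>b\<close>.\<close>

lemma characteristic_matrix_locale:
  fixes G :: "('a, 'b) monoid_scheme" (structure) and p n m :: nat and w :: "int ^ 2 ^ 2"
  assumes "finite_p_group p G"
    and "1 \<le> n" and "1 \<le> m"
    and central: "commutator_subgroup G (derived_subgroup G) (carrier G) \<subseteq> frattini_derived G"
    and iso_F: "G\<lparr>carrier := frattini_derived G\<rparr> \<cong> integer_mod_group p"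
    and iso_Q: "G Mod frattini_derived G \<cong> M_group p n m"
    and matrix: "characteristic_matrix p n m G w"
  obtains a b c where "cyclic_derived_p_group G p n m a b c"
    and "inv\<^bsub>G\<^esub> c \<otimes>\<^bsub>G\<^esub> inv\<^bsub>G\<^esub> a \<otimes>\<^bsub>G\<^esub> c \<otimes>\<^bsub>G\<^esub> a = c [^]\<^bsub>G\<^esub> (w $ 1 $ 2 * int p)"
    and "inv\<^bsub>G\<^esub> c \<otimes>\<^bsub>G\<^esub> inv\<^bsub>G\<^esub> b \<otimes>\<^bsub>G\<^esub> c \<otimes>\<^bsub>G\<^esub> b = c [^]\<^bsub>G\<^esub> (w $ 2 $ 2 * int p)"
proof -
  have p: "prime p" and fin: "finite (carrier G)" and "group G"
    using assms(1) by (auto simp: finite_p_group_def)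
  interpret group G by fact
  have p0: "0 < p" and p1: "1 < p" using p prime_gt_0_nat prime_gt_1_nat by blast+
  define D where "D = derived_subgroup G"
  define F where "F = frattini_derived G"
  have D: "subgroup D G" unfolding D_def by (rule derived_is_subgroup) simp
  have DG: "D \<subseteq> carrier G" using subgroup.subset[OF D] .
  interpret D: group "G\<lparr>carrier := D\<rparr>" using subgroup_imp_group[OF D] .
  have finD: "finite D" using DG fin finite_subset by blast
  have F_frattini: "F = frattini (G\<lparr>carrier := D\<rparr>)"
    by (simp add: F_def frattini_derived_def D_def)
  have FD: "F \<subseteq> D" unfolding F_frattini by (auto simp: frattini_def)
  have F: "subgroup F G"
    using incl_subgroup[OF D] D.frattini_subgroup F_frattini by simp
  \<comment> \<open>\<open>commutator G f (inv x)\<close> lies in \<open>F\<close> by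
    \<open>central\<close>, and multiplying it by \<open>f\<close> on the left gives a conjugate of
    \<open>f\<close>.\<close>
  have "F \<lhd> G"
    unfolding normal_inv_iff
  proof (intro conjI ballI)
    show "subgroup F G" by (rule F)
    fix x f assume xf: "x \<in> carrier G" "f \<in> F"
    have fG: "f \<in> carrier G" using xf(2) FD DG by blast
    have "commutator G f (inv x) \<in> commutator_subgroup G D (carrier G)"
      unfolding commutator_subgroup_def using xf FD by (intro generate.incl) auto
    then have "commutator G f (inv x) \<in> F"
      using central by (auto simp: D_def F_def)
    then have "f \<otimes> (inv f \<otimes> inv (inv x) \<otimes> f \<otimes> inv x) \<in> F"
      using xf(2) subgroup.m_closed[OF F] by (simp add: commutator_def)
    also have "f \<otimes> (inv f \<otimes> inv (inv x) \<otimes> f \<otimes> inv x) = x \<otimes> f \<otimes> inv x"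
      using xf(1) fG by (simp add: m_assoc[symmetric])
    finally show "x \<otimes> f \<otimes> inv x \<in> F" .
  qed
  then interpret F: normal F G .
  define Q where "Q = G Mod F"
  interpret Q: group Q unfolding Q_def by (rule F.factorgroup_is_group)
  have hom: "(#>) F \<in> hom G Q" unfolding Q_def by (rule F.r_coset_hom_Mod)
  interpret q: group_hom G Q "(#>) F"
    by unfold_locales (rule hom)
  have card_F: "card F = p"
    using iso_same_card[OF iso_F] p0 by (simp add: F_def carrier_integer_mod_group)
  have kernel: "x \<in> F" if "x \<in> carrier G" "F #> x = \<one>\<^bsub>Q\<^esub>" for x
    using coset_join1[OF _ that(1) F] that(2) by (simp add: Q_def)
  have same_coset: "\<exists>f\<in>F. x = f \<otimes> y"
    if "x \<in> carrier G" "F #> x = F #> y" for x y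
    using rcos_self[OF that(1) F] that(2) by (auto simp: r_coset_def)

  obtain a b where ab: "a \<in> carrier G" "b \<in> carrier G"
    and gen: "generate Q {F #> a, F #> b} = carrier Q"
    and mat: "commutator Q (F #> a) (F #> b) [^]\<^bsub>Q\<^esub> p = \<one>\<^bsub>Q\<^esub>"
      "commutator Q (commutator Q (F #> a) (F #> b)) (F #> a) = \<one>\<^bsub>Q\<^esub>"
      "commutator Q (commutator Q (F #> a) (F #> b)) (F #> b) = \<one>\<^bsub>Q\<^esub>"
      "a [^] (p ^ n) = commutator G a b [^] (w $ 1 $ 1 * int p)"
      "b [^] (p ^ m) = commutator G a b [^] (w $ 2 $ 1 * int p)"
      "commutator G (commutator G a b) a = commutator G a b [^] (w $ 1 $ 2 * int p)"
      "commutator G (commutator G a b) b = commutator G a b [^] (w $ 2 $ 2 * int p)"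
    using matrix unfolding characteristic_matrix_def Let_def Q_def F_def by auto
  define c where "c = commutator G a b"
  have c: "c \<in> carrier G" using ab by (simp add: c_def commutator_def)
  have cD: "c \<in> D"
  proof -
    have "inv a \<otimes> inv b \<otimes> inv (inv a) \<otimes> inv (inv b) \<in> derived_set G (carrier G)"
      using ab inv_closed by blast
    then show ?thesis
      using ab unfolding D_def derived_def c_def commutator_def by (simp add: generate.incl)
  qed
  define u v e where "u = F #> a" and "v = F #> b" and "e = F #> c"
  have uve: "u \<in> carrier Q" "v \<in> carrier Q" "e \<in> carrier Q"
    using ab c by (simp_all add: u_def v_def e_def)
  have e_eq: "commutator Q u v = e"
    using ab by (simp add: commutator_def e_def u_def v_def c_def)
  have uv: "u \<otimes>\<^bsub>Q\<^esub> v = v \<otimes>\<^bsub>Q\<^esub> u \<otimes>\<^bsub>Q\<^esub> e"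
    using Q.mult_commutator[OF uve(1,2)] e_eq by (simp add: commutator_def)
  have ue: "u \<otimes>\<^bsub>Q\<^esub> e = e \<otimes>\<^bsub>Q\<^esub> u" and ve: "v \<otimes>\<^bsub>Q\<^esub> e = e \<otimes>\<^bsub>Q\<^esub> v"
    using mat(2,3) Q.commutator_eq_one[OF uve(3,1)] Q.commutator_eq_one[OF uve(3,2)] e_eq
    unfolding u_def v_def commutator_def by simp_all
  have gen': "generate Q {u, v} = carrier Q" using gen by (simp add: u_def v_def)
  note class2 = gen' uve uv ue ve

  have e_pow: "e [^]\<^bsub>Q\<^esub> k = F #> c [^] k" for k :: int
    unfolding e_def using c q.hom_int_pow by simp
  have span: "\<exists>(k::int) (i::int) (j::int). \<exists>f\<in>F. x = f \<otimes> (c [^] k \<otimes> (a [^] i \<otimes> b [^] j))"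
    if x: "x \<in> carrier G" for x
  proof -
    obtain k i j :: int where "F #> x = e [^]\<^bsub>Q\<^esub> k \<otimes>\<^bsub>Q\<^esub> (u [^]\<^bsub>Q\<^esub> i \<otimes>\<^bsub>Q\<^esub> v [^]\<^bsub>Q\<^esub> j)"
      using Q.two_generator_normal_form[OF class2 q.hom_closed[OF x]] by blast
    then have "F #> x = F #> (c [^] k \<otimes> (a [^] i \<otimes> b [^] j))"
      using ab c by (simp add: e_pow u_def v_def flip: q.hom_int_pow)
    then show ?thesis using same_coset[OF x] by blast
  qed
  \<comment> \<open>The image of \<open>D\<close> is the derived subgroup of \<open>Q\<close>, which
    consists of powers of \<open>e\<close>.\<close>
  have D_c: "\<exists>(k::int). \<exists>f\<in>F. d = f \<otimes> c [^] k" if d: "d \<in> D" for d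
  proof -
    have dG: "d \<in> carrier G" using d DG by blast
    have "(\<lambda>x. F #> x) ` carrier G = carrier Q"
      by (auto simp: Q_def FactGroup_def RCOSETS_def)
    then have "(\<lambda>x. F #> x) ` D = derived Q (carrier Q)"
      unfolding D_def using q.derived_img[of "carrier G"] by simp
    then have "F #> d \<in> generate Q {e}"
      using Q.two_generator_derived[OF class2] d by blast
    then obtain k :: int where "F #> d = e [^]\<^bsub>Q\<^esub> k"
      using Q.generate_pow[OF uve(3)] by auto
    then show ?thesis using same_coset[OF dG] e_pow by metis
  qed

  have gen_cD: "generate G {c} \<subseteq> D"
    using generate_subgroup_incl[OF _ D] cD by simp
  have D_gen: "D = generate G {c}"
  proof -
    have "subgroup (generate G {c}) (G\<lparr>carrier := D\<rparr>)"
      using subgroup_incl[OF generate_is_subgroup D gen_cD] c by simp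
    moreover have "\<exists>f\<in>F. \<exists>h\<in>generate G {c}. d = f \<otimes> h" if "d \<in> D" for d
      using D_c[OF that] generate_pow[OF c] by auto
    ultimately show ?thesis
      using D.frattini_nongenerators[of "generate G {c}"] finD by (simp add: F_frattini)
  qed
  \<comment> \<open>Otherwise all of \<open>D\<close> would consist of non-generators and the
    trivial subgroup would be \<open>D\<close>, against \<open>card F = p\<close>.\<close>
  have "F \<noteq> D"
  proof
    assume "F = D"
    moreover have "\<exists>f\<in>D. \<exists>h\<in>{\<one>}. d = f \<otimes> h" if "d \<in> D" for d
      by (rule bexI[of _ d], rule bexI[of _ \<one>]) (use that DG in auto)
    ultimately have "{\<one>} = D"
      using D.frattini_nongenerators[OF _ D.triv_subgroup] finD by (simp flip: F_frattini)
    then have "card F = card {\<one>}" using \<open>F = D\<close> by simp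
    then show False using card_F p1 by simp
  qed
  then have "p < card D"
    using psubset_card_mono[OF finD] FD card_F by blast
  moreover have card_D: "card D = ord c"
    using generate_pow_card[OF c] D_gen by simp
  \<comment> \<open>\<open>c [^] p\<close> lies in \<open>F\<close>, which has order
    \<open>p\<close>. With \<open>p < card D\<close> this leaves only \<open>p ^ 2\<close>.\<close>
  moreover have "ord c dvd p ^ 2"
  proof -
    have "F #> c [^] int p = \<one>\<^bsub>Q\<^esub>"
      using mat(1) e_eq by (simp add: u_def v_def flip: e_pow int_pow_int)
    then have cF: "c [^] int p \<in> F" using kernel c by simp
    interpret F': group "G\<lparr>carrier := F\<rparr>" using subgroup_imp_group[OF F] .
    have "(c [^] int p) [^]\<^bsub>G\<lparr>carrier := F\<rparr>\<^esub> order (G\<lparr>carrier := F\<rparr>) = \<one>"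
      using F'.pow_order_eq_1 cF by simp
    then have "(c [^] p) [^] p = \<one>"
      using card_F by (simp add: order_def int_pow_int flip: nat_pow_consistent)
    then have "c [^] (p ^ 2) = \<one>"
      using c by (simp add: nat_pow_pow power2_eq_square)
    then show ?thesis using pow_eq_id c by blast
  qed
  ultimately have ord_c: "ord c = p ^ 2"
    using divides_primepow_nat[OF p, of "ord c" 2] p0
    by (auto simp: le_Suc_eq numeral_2_eq_2)

  have pow_D: "a [^] int (p ^ n) \<in> D" "b [^] int (p ^ m) \<in> D"
    unfolding D_gen generate_pow[OF c] int_pow_int mat(4,5)[folded c_def] by blast+
  have span_D: "\<exists>(i::int) (j::int). \<exists>d\<in>D. x = d \<otimes> (a [^] i \<otimes> b [^] j)"
    if x: "x \<in> carrier G" for x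
  proof -
    obtain k i j :: int and f where f: "f \<in> F" "x = f \<otimes> (c [^] k \<otimes> (a [^] i \<otimes> b [^] j))"
      using span[OF x] by blast
    have "f \<otimes> c [^] k \<in> D"
      using f(1) FD cD by (intro subgroup.m_closed[OF D] subgroup_int_pow_closed[OF D]) auto
    moreover have "x = f \<otimes> c [^] k \<otimes> (a [^] i \<otimes> b [^] j)"
      using f FD DG ab c by (subst m_assoc) auto
    ultimately show ?thesis by blast
  qed

  let ?A = "integer_mod_group (p ^ n) \<times>\<times> integer_mod_group (p ^ m)"
  have A: "comm_group ?A"
    by (rule group.group_comm_groupI) (auto simp: DirProd_group add.commute)
  obtain h where h: "h \<in> hom (M_group p n m) ?A" "h ` carrier (M_group p n m) = carrier ?A"
    using M_group_abelianization[OF p] by blast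
  obtain g where g: "g \<in> iso Q (M_group p n m)"
    using iso_Q unfolding is_iso_def Q_def F_def by blast
  \<comment> \<open>The composite from \<open>G\<close> through \<open>Q\<close> and
    \<open>M_group p n m\<close> to \<open>?A\<close>; it is onto, and trivial on \<open>D\<close>
    because \<open>?A\<close> is abelian.\<close>
  define \<psi> where "\<psi> = h \<circ> g \<circ> (\<lambda>x. F #> x)"
  have "g \<in> hom Q (M_group p n m)" using g by (simp add: iso_def)
  then have "\<psi> \<in> hom G ?A"
    unfolding \<psi>_def by (intro Group.hom_compose[OF hom] Group.hom_compose[OF _ h(1)])
  then interpret \<psi>: group_hom G ?A \<psi>
    by (intro group_hom.intro group_hom_axioms.intro is_group comm_group.axioms(2)[OF A])
  have surj: "\<psi> ` carrier G = carrier ?A"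
  proof -
    have "(\<lambda>x. F #> x) ` carrier G = carrier Q"
      by (auto simp: Q_def FactGroup_def RCOSETS_def)
    moreover have "g ` carrier Q = carrier (M_group p n m)"
      using g by (simp add: iso_def bij_betw_def)
    ultimately show ?thesis unfolding \<psi>_def using h(2) by (simp only: image_comp[symmetric])
  qed
  have card_A: "card (carrier ?A) = p ^ n * p ^ m"
    using p0 by (simp add: DirProd_def carrier_integer_mod_group card_cartesian_product nat_power_eq)
  have \<psi>_D: "\<psi> d = \<one>\<^bsub>?A\<^esub>" if "d \<in> D" for d
    using \<psi>.derived_img[of "carrier G"] comm_group.derived_eq_singleton[OF A] that surj
    unfolding D_def by blast
  \<comment> \<open>The assumptions of the counting context for \<open>N = p ^ n\<close> and
    \<open>M = p ^ m\<close>; the gaps are the positivity conditions.\<close>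
  note quotient_facts = surj card_A _ _ ab D \<psi>_D span_D pow_D
  have "order G = p ^ n * p ^ m * card D"
    using \<psi>.order_eq[OF quotient_facts] p0 by simp
  then have order: "order G = p ^ (n + m + 2)"
    using card_D ord_c by (simp add: power_add power2_eq_square)
  have indep: "int p ^ n dvd i \<and> int p ^ m dvd j" if "a [^] (i::int) \<otimes> b [^] (j::int) \<in> D" for i j
    using \<psi>.exponents_dvd[OF quotient_facts, of i j] \<psi>_D[OF that] p0 by simp
  have comm_ab: "a \<otimes> b = b \<otimes> a \<otimes> c"
    using mult_commutator[OF ab] by (simp add: c_def commutator_def)
  \<comment> \<open>Passes from the commutators in the matrix to the conjugates in the
    locale.\<close>
  have conj: "inv g \<otimes> c \<otimes> g = c [^] (1 + t)"
    if "g \<in> carrier G" "commutator G c g = c [^] t" for g and t :: int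
  proof -
    have "c [^] (1 + t) = c \<otimes> (inv c \<otimes> inv g \<otimes> c \<otimes> g)"
      using that c by (simp add: int_pow_mult flip: that(2) commutator_def)
    then show ?thesis using that(1) c by (simp add: m_assoc mult_inv_cancel)
  qed
  have "cyclic_derived_p_group G p n m a b c"
  proof unfold_locales
    show "prime p" "1 \<le> n" "1 \<le> m" "finite (carrier G)" "order G = p ^ (n + m + 2)"
      "a \<in> carrier G" "b \<in> carrier G" "c \<in> carrier G" "ord c = p ^ 2" "a \<otimes> b = b \<otimes> a \<otimes> c"
      by fact+
    show "derived_subgroup G = generate G {c}" using D_gen D_def by simp
    show "\<exists>k::int. inv a \<otimes> c \<otimes> a = c [^] (1 + k * int p)"
      "\<exists>k::int. inv b \<otimes> c \<otimes> b = c [^] (1 + k * int p)"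
      using conj ab mat(6,7) unfolding c_def by blast+
    show "\<exists>k::int. a [^] (int p ^ n) = c [^] (k * int p)" "\<exists>k::int. b [^] (int p ^ m) = c [^] (k * int p)"
      using mat(4,5) int_pow_int[of G a "p ^ n"] int_pow_int[of G b "p ^ m"] unfolding c_def by auto
  qed (use span_D indep in \<open>auto simp: D_def\<close>)
  then show thesis
    using that mat(6,7) unfolding c_def commutator_def by blast
qed

theorem theorem3p2:
  fixes G :: "('a, 'b) monoid_scheme" and p n m :: nat and w :: "int ^ 2 ^ 2"
  assumes "prime p"
    and "finite_p_group p G"
    and "1 \<le> m" and "m \<le> n" and "p = 2 \<Longrightarrow> n > 1"
    and "commutator_subgroup G (derived_subgroup G) (carrier G) \<subseteq> frattini_derived G"
    and "G\<lparr>carrier := frattini_derived G\<rparr> \<cong> integer_mod_group p"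
    and "G Mod frattini_derived G \<cong> M_group p n m"
    and "characteristic_matrix p n m G w"
  shows "(w $ 2 $ 2 = \<zero>\<^bsub>residue_ring (int p)\<^esub> \<and> w $ 1 $ 2 = \<zero>\<^bsub>residue_ring (int p)\<^esub>
            \<longrightarrow> class_A p 3 G) \<and>
         (w $ 2 $ 2 = \<zero>\<^bsub>residue_ring (int p)\<^esub> \<and> w $ 1 $ 2 \<noteq> \<zero>\<^bsub>residue_ring (int p)\<^esub>
            \<longrightarrow> class_A p (m + 1) G) \<and>
         (w $ 2 $ 2 \<noteq> \<zero>\<^bsub>residue_ring (int p)\<^esub> \<and> w $ 1 $ 2 = \<zero>\<^bsub>residue_ring (int p)\<^esub>
            \<longrightarrow> class_A p (n + 1) G)"
proof -
  have "1 \<le> n" using assms(3,4) by simp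
  then obtain a b c where loc: "cyclic_derived_p_group G p n m a b c"
    and w: "inv\<^bsub>G\<^esub> c \<otimes>\<^bsub>G\<^esub> inv\<^bsub>G\<^esub> a \<otimes>\<^bsub>G\<^esub> c \<otimes>\<^bsub>G\<^esub> a = c [^]\<^bsub>G\<^esub> (w $ 1 $ 2 * int p)"
      "inv\<^bsub>G\<^esub> c \<otimes>\<^bsub>G\<^esub> inv\<^bsub>G\<^esub> b \<otimes>\<^bsub>G\<^esub> c \<otimes>\<^bsub>G\<^esub> b = c [^]\<^bsub>G\<^esub> (w $ 2 $ 2 * int p)"
    using characteristic_matrix_locale[OF assms(2) _ assms(3,6-9)] by blast
  interpret cyclic_derived_p_group G p n m a b c by fact
  \<comment> \<open>Serves the third case, in which \<open>a\<close> centralizes \<open>c\<close>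
    and \<open>p ^ n\<close> becomes the maximal index.\<close>
  interpret swapped: cyclic_derived_p_group G p m n b a "inv\<^bsub>G\<^esub> c" by (rule swap)
  have zero: "\<zero>\<^bsub>residue_ring (int p)\<^esub> = 0" by (simp add: residue_ring_def)
  have range: "0 \<le> w $ i $ j" "w $ i $ j < int p" for i j
    using assms(9) unfolding characteristic_matrix_def residue_ring_def by auto
  \<comment> \<open>As \<open>c\<close> has order \<open>p ^ 2\<close>, the commutator is trivial
    exactly if \<open>p\<close> divides the entry, and \<open>0\<close> is the only multiple of
    \<open>p\<close> among the representatives.\<close>
  have commute_iff: "g \<otimes>\<^bsub>G\<^esub> c = c \<otimes>\<^bsub>G\<^esub> g \<longleftrightarrow> w $ i $ j = 0"
    if g: "g \<in> carrier G"
      "inv\<^bsub>G\<^esub> c \<otimes>\<^bsub>G\<^esub> inv\<^bsub>G\<^esub> g \<otimes>\<^bsub>G\<^esub> c \<otimes>\<^bsub>G\<^esub> g = c [^]\<^bsub>G\<^esub> (w $ i $ j * int p)" for g i j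
  proof -
    have "g \<otimes>\<^bsub>G\<^esub> c = c \<otimes>\<^bsub>G\<^esub> g \<longleftrightarrow> c [^]\<^bsub>G\<^esub> (w $ i $ j * int p) = \<one>\<^bsub>G\<^esub>"
      unfolding g(2)[symmetric] using g(1) by (auto simp: m_assoc inv_solve_left')
    also have "\<dots> \<longleftrightarrow> int p dvd w $ i $ j"
      using p_pos by (simp add: c_pow_eq_one power2_eq_square)
    also have "\<dots> \<longleftrightarrow> w $ i $ j = 0"
      using range[of i j] zdvd_not_zless[of "w $ i $ j" "int p"] by (cases "w $ i $ j = 0") auto
    finally show ?thesis .
  qed
  have inv_iff: "g \<otimes>\<^bsub>G\<^esub> inv\<^bsub>G\<^esub> c = inv\<^bsub>G\<^esub> c \<otimes>\<^bsub>G\<^esub> g \<longleftrightarrow> g \<otimes>\<^bsub>G\<^esub> c = c \<otimes>\<^bsub>G\<^esub> g"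
    if "g \<in> carrier G" for g
    using that commute_int_pow_right[of g c "-1"] commute_int_pow_right[of g "inv\<^bsub>G\<^esub> c" "-1"]
    by (auto simp: int_pow_neg)
  note iff = commute_iff[OF abc_closed(1) w(1)] commute_iff[OF abc_closed(2) w(2)]
  show ?thesis
    unfolding zero iff[symmetric]
    using class_A_central class_A_noncentral swapped.class_A_noncentral
    by (simp add: inv_iff)
qed

end
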